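(* Let $\mathbb{H}=\{(z_1,z_2)\in\mathbb{C}^2:\ |z_2|<|z_1|<1\}$ be the Hartogs triangle and let $\mu(z)=\exp\left(-\frac{1}{|z_1|}\right)$ for $z=(z_1,z_2)\in\mathbb{H}$. Let $p\in(1,\infty)$. Then the weighted Bergman projection $\mathbf{B}^{\mu}_{\mathbb{H}}$ is bounded on $L^p(\mathbb{H},\mu)$ if and only if $p=2$.
   Context: $dV$ denotes Lebesgue measure on $\mathbb{C}^2$. For $p\in(1,\infty)$, $L^p(\mathbb{H},\mu)$ is the space of measurable functions $f:\mathbb{H}\to\mathbb{C}$ with $\|f\|_{p,\mu}^p=\int_{\mathbb{H}}|f(z)|^p\mu(z)\,dV(z)<\infty$. $L^2_a(\mathbb{H},\mu)$ is the space of holomorphic functions on $\mathbb{H}$ lying in $L^2(\mathbb{H},\mu)$; it is a closed subspace of $L^2(\mathbb{H},\mu)$. The weighted Bergman projection $\mathbf{B}^{\mu}_{\mathbb{H}}$ is the orthogonal projection from $L^2(\mathbb{H},\mu)$ onto $L^2_a(\mathbb{H},\mu)$. It is an integral operator $\mathbf{B}^{\mu}_{\mathbb{H}}f(z)=\int_{\mathbb{H}}B^{\mu}_{\mathbb{H}}(z,w)f(w)\mu(w)\,dV(w)$, where $B^{\mu}_{\mathbb{H}}$ is the weighted Bergman kernel. "Bounded on $L^p(\mathbb{H},\mu)$" means that there is a constant $C>0$ with $\|\mathbf{B}^{\mu}_{\mathbb{H}}f\|_{p,\mu}\le C\|f\|_{p,\mu}$ for all $f\in L^2(\mathbb{H},\mu)\cap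 L^p(\mathbb{H},\mu)$ (equivalently, that the operator extends to a bounded operator from $L^p(\mathbb{H},\mu)$ to itself). *)

theory Defs
  imports "HOL-Analysis.Analysis"
begin

text \<open>The type \<^typ>\<open>complex \<times> complex\<close> plays the role of $\mathbb{C}^2$; its Lebesgue measure
  is the one of the underlying four-dimensional Euclidean space.\<close>

definition holomorphic2_on :: "(complex \<times> complex \<Rightarrow> complex) \<Rightarrow> (complex \<times> complex) set \<Rightarrow> bool"
    (infixl "holomorphic2'_on" 50)
  where "f holomorphic2_on \<Omega> \<longleftrightarrow>
    (\<forall>z\<in>\<Omega>. \<exists>a b. (f has_derivative (\<lambda>h. a * fst h + b * snd h)) (at z within \<Omega>))"

definition weighted_measure ::
    "(complex \<times> complex) set \<Rightarrow> (complex \<times> complex \<Rightarrow> real) \<Rightarrow> (complex \<times> complex) measure"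
  where "weighted_measure \<Omega> \<mu> = density (lebesgue_on \<Omega>) (\<lambda>z. ennreal (\<mu> z))"

text \<open>Elements of the $L^p$ spaces are functions, not equivalence classes, and only their values
  on \<open>\<Omega>\<close> matter.\<close>

definition Lp_space :: "real \<Rightarrow> (complex \<times> complex) set \<Rightarrow> (complex \<times> complex \<Rightarrow> real)
    \<Rightarrow> (complex \<times> complex \<Rightarrow> complex) set"
  where "Lp_space p \<Omega> \<mu> =
    {f \<in> borel_measurable (weighted_measure \<Omega> \<mu>).
       (\<integral>\<^sup>+z. ennreal (cmod (f z) powr p) \<partial>weighted_measure \<Omega> \<mu>) < \<infinity>}"

definition Lp_norm :: "real \<Rightarrow> (complex \<times> complex) set \<Rightarrow> (complex \<times> complex \<Rightarrow> real)
    \<Rightarrow> (complex \<times> complex \<Rightarrow> complex) \<Rightarrow> real"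
  where "Lp_norm p \<Omega> \<mu> f =
    (\<integral>z. cmod (f z) powr p \<partial>weighted_measure \<Omega> \<mu>) powr (1 / p)"

definition L2_inner :: "(complex \<times> complex) set \<Rightarrow> (complex \<times> complex \<Rightarrow> real)
    \<Rightarrow> (complex \<times> complex \<Rightarrow> complex) \<Rightarrow> (complex \<times> complex \<Rightarrow> complex) \<Rightarrow> complex"
  where "L2_inner \<Omega> \<mu> f g = (\<integral>z. f z * cnj (g z) \<partial>weighted_measure \<Omega> \<mu>)"

definition bergman_space :: "(complex \<times> complex) set \<Rightarrow> (complex \<times> complex \<Rightarrow> real)
    \<Rightarrow> (complex \<times> complex \<Rightarrow> complex) set"
  where "bergman_space \<Omega> \<mu> = {f \<in> Lp_space 2 \<Omega> \<mu>. f holomorphic2_on \<Omega>}"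

text \<open>The value 0 outside \<open>\<Omega>\<close> singles out one total function: for open \<open>\<Omega>\<close> and a positive weight,
  holomorphic functions that agree almost everywhere on \<open>\<Omega>\<close> agree everywhere on \<open>\<Omega>\<close>.\<close>

definition bergman_projection :: "(complex \<times> complex) set \<Rightarrow> (complex \<times> complex \<Rightarrow> real)
    \<Rightarrow> (complex \<times> complex \<Rightarrow> complex) \<Rightarrow> (complex \<times> complex \<Rightarrow> complex)"
  where "bergman_projection \<Omega> \<mu> f =
    (THE g. g \<in> bergman_space \<Omega> \<mu> \<and> (\<forall>z. z \<notin> \<Omega> \<longrightarrow> g z = 0) \<and>
       (\<forall>h\<in>bergman_space \<Omega> \<mu>. L2_inner \<Omega> \<mu> (\<lambda>z. f z - g z) h = 0))"

text \<open>Membership of the image in $L^p$ is required explicitly because \<^const>\<open>Lp_norm\<close> is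
  meaningless (namely 0) where the integral diverges.\<close>

definition bergman_projection_bounded ::
    "real \<Rightarrow> (complex \<times> complex) set \<Rightarrow> (complex \<times> complex \<Rightarrow> real) \<Rightarrow> bool"
  where "bergman_projection_bounded p \<Omega> \<mu> \<longleftrightarrow>
    (\<exists>C>0. \<forall>f \<in> Lp_space 2 \<Omega> \<mu> \<inter> Lp_space p \<Omega> \<mu>.
       bergman_projection \<Omega> \<mu> f \<in> Lp_space p \<Omega> \<mu> \<and>
       Lp_norm p \<Omega> \<mu> (bergman_projection \<Omega> \<mu> f) \<le> C * Lp_norm p \<Omega> \<mu> f)"

definition hartogs_triangle :: "(complex \<times> complex) set"
  where "hartogs_triangle = {(z1, z2). cmod z2 < cmod z1 \<and> cmod z1 < 1}"

definition hartogs_weight :: "complex \<times> complex \<Rightarrow> real"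
  where "hartogs_weight z = exp (- (1 / cmod (fst z)))"

end

theory Submission
  imports Defs "HOL-Complex_Analysis.Complex_Analysis"
begin

text \<open>
  For \<open>p = 2\<close> the projection is orthogonal, so it does not increase the norm. What has to be checked
  is that it exists, that is, that the Bergman space is closed in \<open>L\<^sup>2\<close>. This holds for every open
  set with a continuous positive weight: point evaluations are bounded on the Bergman space, locally
  uniformly in the point (\<open>bergman_point_evaluation\<close>), so a minimizing sequence for the distance to
  the Bergman space converges locally uniformly to a holomorphic function, and Fatou's lemma shows that
  this limit attains the distance (\<open>bergman_projection_exists\<close>).

  For \<open>p \<noteq> 2\<close> let \<open>q\<close> be the conjugate exponent. All negative powers of \<open>z\<^sub>1\<close> lie in the Bergman
  space, because the weight vanishes to infinite order at the origin. Averaging over the torus action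
  on the triangle shows that a function \<open>\<phi>(\<bar>z\<^sub>1\<bar>) z\<^sub>1\<^sup>-\<^sup>n\<close> is projected to a multiple of \<open>z\<^sub>1\<^sup>-\<^sup>n\<close>
  (\<open>projection_of_monomial\<close>). Write \<open>A(s)\<close> for the integral of \<open>\<bar>z\<^sub>1\<bar>\<^sup>-\<^sup>s\<close> against the weighted
  measure. With \<open>\<phi>(r) = r\<^sup>n\<^sup>(\<^sup>2\<^sup>-\<^sup>q\<^sup>)\<close>, the choice that gives equality in Hoelder's inequality for the
  pairing with \<open>z\<^sub>1\<^sup>-\<^sup>n\<close>, boundedness on \<open>L\<^sup>p\<close> becomes
  \<open>A(nq)\<^sup>1\<^sup>/\<^sup>q A(np)\<^sup>1\<^sup>/\<^sup>p \<le> C A(2n)\<close> for all \<open>n\<close> (\<open>bounded_imp_moment_inequality\<close>).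
  In the variable \<open>t = 1/\<bar>z\<^sub>1\<bar>\<close> the integrand of \<open>A(s)\<close> is \<open>t\<^sup>s e\<^sup>-\<^sup>t\<close>, whose maximum \<open>s\<^sup>s e\<^sup>-\<^sup>s\<close> at \<open>t = s\<close>
  gives the size of \<open>A(s)\<close> up to powers of \<open>s\<close> (\<open>moment_upper\<close>, \<open>moment_lower\<close>). Up to powers of
  \<open>n\<close> the left side is therefore \<open>(n\<^sup>2pq)\<^sup>n e\<^sup>-\<^sup>2\<^sup>n\<close> and the right side is \<open>(2n)\<^sup>2\<^sup>n e\<^sup>-\<^sup>2\<^sup>n\<close>. Their ratio
  is \<open>(pq/4)\<^sup>n\<close>, and \<open>pq > 4\<close> unless \<open>p = q = 2\<close>.

  Mean values over circles are integrated over the domain by Fubini's theorem and the invariance of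
  Lebesgue measure under rotations (\<open>integral_lborel_average\<close>).
\<close>

section \<open>Averages over rotations\<close>

text \<open>The image measure \<open>\<nu>\<close> is translation invariant, and translation invariant measures are unique
  up to a factor. For a set \<open>A\<close> and the unit ball \<open>B\<close>, Fubini's theorem and the invariance of both
  measures turn the product \<open>\<nu>(A) \<lambda>(B)\<close> into \<open>\<nu>(B) \<lambda>(A)\<close>. The factor is \<open>1\<close> because an isometry
  maps \<open>B\<close> to itself.\<close>

lemma lborel_distr_linear_isometry:
  fixes T :: "'a::euclidean_space \<Rightarrow> 'a"
  assumes "linear T" and iso: "\<And>x. norm (T x) = norm x"
  shows "distr lborel borel T = lborel"
proof -
  have bl: "bounded_linear T" using assms(1) by (simp add: linear_conv_bounded_linear)
  have contT: "continuous_on UNIV T"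
    using bl by (intro linear_continuous_on)
  have [measurable]: "T \<in> borel_measurable borel"
    using contT by (rule borel_measurable_continuous_onI)
  have injT: "inj T"
  proof (rule injI)
    fix x y assume "T x = T y"
    then have "norm (T (x - y)) = 0" using assms(1) by (simp add: linear_diff)
    then show "x = y" using iso by simp
  qed
  have surjT: "surj T" using injT assms(1) linear_injective_imp_surjective by blast
  define \<nu> where "\<nu> = distr lborel borel T"
  have sets_\<nu>[measurable_cong, simp]: "sets \<nu> = sets borel" by (simp add: \<nu>_def)
  define B where "B = ball (0::'a) 1"
  have B[measurable]: "B \<in> sets borel" by (simp add: B_def)
  have vimB: "T -` B = B" by (auto simp: B_def iso)
  have nuB: "emeasure \<nu> B = emeasure lborel B"
    unfolding \<nu>_def by (subst emeasure_distr) (auto simp: vimB)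
  have Bfin: "emeasure lborel B < \<infinity>" unfolding B_def by (rule emeasure_lborel_ball_finite)
  have Bpos: "emeasure lborel B \<noteq> 0"
    unfolding B_def
  proof
    assume "emeasure lborel (ball (0::'a) 1) = 0"
    then have "measure lborel (ball (0::'a) 1) = 0" by (simp add: measure_def)
    then show False using content_ball_gt_0_iff[of "0::'a" 1] by linarith
  qed
  have trans: "(\<integral>\<^sup>+x. f (c + x) \<partial>lborel) = (\<integral>\<^sup>+x. f x \<partial>lborel)"
    if [measurable]: "f \<in> borel_measurable borel" for f :: "'a \<Rightarrow> ennreal" and c :: 'a
    by (subst (2) lborel_distr_plus[of c, symmetric]) (simp add: nn_integral_distr)
  have refl: "(\<integral>\<^sup>+x. f (- x) \<partial>lborel) = (\<integral>\<^sup>+x. f x \<partial>lborel)"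
    if [measurable]: "f \<in> borel_measurable borel" for f :: "'a \<Rightarrow> ennreal"
  proof -
    have "(lborel :: 'a measure) = distr lborel borel uminus"
      using lborel_affine[of "-1" "0::'a"] by (simp add: density_1)
    then have "(\<integral>\<^sup>+x. f x \<partial>lborel) = (\<integral>\<^sup>+x. f x \<partial>distr lborel borel uminus)" by simp
    also have "\<dots> = (\<integral>\<^sup>+x. f (- x) \<partial>lborel)" by (rule nn_integral_distr) auto
    finally show ?thesis by simp
  qed
  have transnu: "(\<integral>\<^sup>+x. f (x + c) \<partial>\<nu>) = (\<integral>\<^sup>+x. f x \<partial>\<nu>)"
    if [measurable]: "f \<in> borel_measurable borel" for f :: "'a \<Rightarrow> ennreal" and c :: 'a
  proof -
    obtain d where d: "c = T d" using surjT by (metis surjD)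
    have "(\<integral>\<^sup>+x. f (x + c) \<partial>\<nu>) = (\<integral>\<^sup>+x. f (T (d + x)) \<partial>lborel)"
      unfolding \<nu>_def using assms(1) by (simp add: nn_integral_distr d linear_add add.commute)
    also have "\<dots> = (\<integral>\<^sup>+x. f (T x) \<partial>lborel)" by (rule trans) simp
    also have "\<dots> = (\<integral>\<^sup>+x. f x \<partial>\<nu>)" unfolding \<nu>_def by (simp add: nn_integral_distr)
    finally show ?thesis .
  qed
  have sf: "sigma_finite_measure \<nu>"
  proof
    show "\<exists>A. countable A \<and> A \<subseteq> sets \<nu> \<and> \<Union> A = space \<nu> \<and> (\<forall>a\<in>A. emeasure \<nu> a \<noteq> \<infinity>)"
    proof (intro exI conjI ballI)
      let ?A = "range (\<lambda>n::nat. ball (0::'a) (real n))"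
      show "countable ?A" by simp
      show "?A \<subseteq> sets \<nu>" by (simp add: image_subset_iff)
      have "x \<in> \<Union> ?A" for x
        using reals_Archimedean2[of "norm x"] by simp
      then show "\<Union> ?A = space \<nu>" by (simp add: \<nu>_def set_eq_iff)
      fix a assume "a \<in> ?A"
      then obtain n :: nat where a: "a = ball 0 (real n)" by auto
      have "T -` a = a" by (auto simp: a iso)
      then have "emeasure \<nu> a = emeasure lborel a"
        unfolding \<nu>_def by (subst emeasure_distr) (auto simp: a)
      then show "emeasure \<nu> a \<noteq> \<infinity>" unfolding a
        using emeasure_lborel_ball_finite[of "0::'a" "real n"] by (metis infinity_ennreal_def less_irrefl)
    qed
  qed
  interpret nu: sigma_finite_measure \<nu> by fact
  interpret P: pair_sigma_finite \<nu> "lborel :: 'a measure" ..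
  have "emeasure \<nu> A = emeasure lborel A" if A[measurable]: "A \<in> sets borel" for A
  proof -
    have "emeasure \<nu> A * emeasure lborel B = (\<integral>\<^sup>+x. \<integral>\<^sup>+y. indicator A x * indicator B y \<partial>lborel \<partial>\<nu>)"
      by (simp add: nn_integral_cmult nn_integral_multc)
    also have "\<dots> = (\<integral>\<^sup>+x. \<integral>\<^sup>+y. indicator A x * indicator B (x + y) \<partial>lborel \<partial>\<nu>)"
      by (simp add: nn_integral_cmult trans)
    also have "\<dots> = (\<integral>\<^sup>+y. \<integral>\<^sup>+x. indicator A x * indicator B (x + y) \<partial>\<nu> \<partial>lborel)"
      by (rule P.Fubini'[symmetric]) simp
    also have "\<dots> = (\<integral>\<^sup>+y. \<integral>\<^sup>+x. indicator A (x + (- y)) * indicator B ((x + (-y)) + y) \<partial>\<nu> \<partial>lborel)"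
      by (intro nn_integral_cong transnu[symmetric]) simp
    also have "\<dots> = (\<integral>\<^sup>+y. \<integral>\<^sup>+x. indicator A (x - y) * indicator B x \<partial>\<nu> \<partial>lborel)"
      by simp
    also have "\<dots> = (\<integral>\<^sup>+x. \<integral>\<^sup>+y. indicator A (x - y) * indicator B x \<partial>lborel \<partial>\<nu>)"
      by (rule P.Fubini') simp
    also have "\<dots> = (\<integral>\<^sup>+x. emeasure lborel A * indicator B x \<partial>\<nu>)"
    proof (rule nn_integral_cong)
      fix x
      have "(\<integral>\<^sup>+y. indicator A (x - y) \<partial>lborel) = (\<integral>\<^sup>+y. indicator A (x + y) \<partial>lborel)"
        using refl[of "\<lambda>y. indicator A (x + y)"] by simp
      also have "\<dots> = emeasure lborel A" by (simp add: trans)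
      finally show "(\<integral>\<^sup>+y. indicator A (x - y) * indicator B x \<partial>lborel) = emeasure lborel A * indicator B x"
        by (simp add: nn_integral_multc)
    qed
    also have "\<dots> = emeasure lborel A * emeasure lborel B"
      by (simp add: nn_integral_cmult nuB)
    finally show ?thesis
      using Bfin Bpos by (auto simp: ennreal_mult_cancel_left mult.commute[of _ "emeasure lborel B"])
  qed
  then show ?thesis
    unfolding \<nu>_def[symmetric] by (intro measure_eqI) auto
qed

text \<open>Integrals over every rotated copy of \<open>G\<close> agree, so they agree with their average over \<open>t\<close>, and
  Fubini's theorem moves that average inside. Continuity in \<open>t\<close> makes the inner average the same
  as a Lebesgue integral and as a gauge integral; the latter is the form used for mean values.\<close>

lemma integral_lborel_average:
  fixes G :: "'a::euclidean_space \<Rightarrow> complex" and T :: "real \<Rightarrow> 'a \<Rightarrow> 'a"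
  assumes G: "integrable lborel G" and [measurable]: "G \<in> borel_measurable borel"
    and T[measurable]: "(\<lambda>(t, z). T t z) \<in> borel_measurable (borel \<Otimes>\<^sub>M borel)"
    and lin: "\<And>t. linear (T t)" and iso: "\<And>t z. norm (T t z) = norm z"
    and cont: "\<And>z. continuous_on {0..1} (\<lambda>t. G (T t z))"
  shows "integrable lborel (\<lambda>z. integral {0..1} (\<lambda>t. G (T t z)))"
    and "(\<integral>z. integral {0..1} (\<lambda>t. G (T t z)) \<partial>lborel) = (\<integral>z. G z \<partial>lborel)"
proof -
  define F where "F = (\<lambda>(t::real) z. indicator {0..1} t *\<^sub>R G (T t z))"
  have Tm[measurable]: "T t \<in> borel_measurable borel" for t
    using lin[of t] by (intro borel_measurable_continuous_onI linear_continuous_on)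
      (simp add: linear_conv_bounded_linear)
  have int: "integrable lborel (\<lambda>z. g (T t z)) \<and> (\<integral>z. g (T t z) \<partial>lborel) = (\<integral>z. g z \<partial>lborel)"
    if "integrable lborel g" and [measurable]: "g \<in> borel_measurable borel"
    for g :: "'a \<Rightarrow> 'b::{banach, second_countable_topology}" and t
  proof -
    have eq: "lborel = distr lborel borel (T t)"
      using lborel_distr_linear_isometry[OF lin iso] by simp
    have "integrable (distr lborel borel (T t)) g" using that eq by simp
    then have 1: "integrable lborel (\<lambda>z. g (T t z))"
      by (subst (asm) integrable_distr_eq) auto
    have "(\<integral>z. g z \<partial>distr lborel borel (T t)) = (\<integral>z. g (T t z) \<partial>lborel)"
      by (subst integral_distr) auto
    with 1 eq show ?thesis by simp
  qed
  have Gn: "integrable lborel (\<lambda>z. norm (G z))" using G by simp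
  have meas: "case_prod F \<in> borel_measurable (lborel \<Otimes>\<^sub>M lborel)"
  proof -
    have "(\<lambda>x. case_prod T x) \<in> borel_measurable (lborel \<Otimes>\<^sub>M lborel)"
      by (subst measurable_cong_sets[OF sets_pair_measure_cong[OF sets_lborel sets_lborel] refl]) (rule T)
    then show ?thesis unfolding F_def by measurable
  qed
  have FI: "integrable (lborel \<Otimes>\<^sub>M lborel) (case_prod F)"
  proof (rule lborel_pair.Fubini_integrable[OF meas])
    have eq: "(\<integral>z. norm (F t z) \<partial>lborel) = indicator {0..1} t *\<^sub>R (\<integral>z. norm (G z) \<partial>lborel)" for t
      using int[OF Gn, of t] by (simp add: F_def indicator_def)
    show "integrable lborel (\<lambda>t. \<integral>z. norm (case_prod F (t, z)) \<partial>lborel)"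
      by (simp add: eq)
    show "AE t in lborel. integrable lborel (\<lambda>z. case_prod F (t, z))"
      using int[OF G] by (simp add: F_def)
  qed
  have K: "(\<integral>t. F t z \<partial>lborel) = integral {0..1} (\<lambda>t. G (T t z))" for z
  proof -
    have "set_integrable lborel {0..1} (\<lambda>t. G (T t z))"
      unfolding set_integrable_def using cont by (intro borel_integrable_compact) auto
    then show ?thesis
      using set_borel_integral_eq_integral(2) by (simp add: F_def set_lebesgue_integral_def)
  qed
  show "integrable lborel (\<lambda>z. integral {0..1} (\<lambda>t. G (T t z)))"
    using lborel_pair.integrable_snd[OF FI] by (simp add: K)
  have "(\<integral>z. (\<integral>t. F t z \<partial>lborel) \<partial>lborel) = (\<integral>t. (\<integral>z. F t z \<partial>lborel) \<partial>lborel)"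
    by (rule lborel_pair.Fubini_integral[OF FI])
  also have "\<dots> = (\<integral>t. indicator {0..1::real} t *\<^sub>R (\<integral>z. G z \<partial>lborel) \<partial>lborel)"
    using int[OF G] by (intro Bochner_Integration.integral_cong) (auto simp: F_def)
  also have "\<dots> = (\<integral>z. G z \<partial>lborel)" by simp
  finally show "(\<integral>z. integral {0..1} (\<lambda>t. G (T t z)) \<partial>lborel) = (\<integral>z. G z \<partial>lborel)"
    by (simp add: K)
qed

definition turn :: "real \<Rightarrow> complex" where "turn t = cis (2 * pi * t)"

lemma norm_turn [simp]: "cmod (turn t) = 1" by (simp add: turn_def)

lemma turn_0 [simp]: "turn 0 = 1" and turn_1 [simp]: "turn 1 = 1"
  by (auto simp: turn_def)

lemma turn_nonzero [simp]: "turn t \<noteq> 0" by (simp add: turn_def)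

lemma turn_has_vector_derivative:
  "(turn has_vector_derivative (2 * pi * \<i> * turn t)) (at t within S)"
proof -
  have "((\<lambda>z. exp (2 * pi * \<i> * z)) has_field_derivative 2 * pi * \<i> * exp (2 * pi * \<i> * of_real t)) (at (of_real t))"
    by (auto intro!: derivative_eq_intros)
  then have "((\<lambda>t. exp (2 * pi * \<i> * of_real t)) has_vector_derivative 2 * pi * \<i> * exp (2 * pi * \<i> * of_real t)) (at t within S)"
    by (rule has_vector_derivative_real_field)
  moreover have eq: "turn s = exp (2 * pi * \<i> * of_real s)" for s
    by (simp add: turn_def cis_conv_exp mult_ac)
  ultimately show ?thesis by (simp add: eq[abs_def])
qed

lemma continuous_on_turn [continuous_intros]:
  "continuous_on S f \<Longrightarrow> continuous_on S (\<lambda>x. turn (f x))"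
  unfolding turn_def by (intro continuous_intros)

text \<open>The derivative of the circular mean in \<open>u\<close> is the integral of \<open>turn t * deriv k (u * turn t)\<close>.
  Up to the factor \<open>2\<pi>\<i>u\<close> this is the derivative of \<open>t \<mapsto> k (u * turn t)\<close>, which integrates to \<open>0\<close>
  over a full turn. On a disc (take \<open>v = 0\<close>) this is the mean value property; on a punctured disc it
  says that the constant Laurent coefficient does not depend on the radius or on the starting angle.\<close>

lemma rotation_mean_constant:
  assumes hol: "k holomorphic_on S" and S: "open S" "connected S"
    and rot: "\<And>u t. u \<in> S \<Longrightarrow> u * turn t \<in> S" and u: "u \<in> S" and v: "v \<in> S"
  shows "integral {0..1} (\<lambda>t. k (u * turn t)) = integral {0..1} (\<lambda>t. k (v * turn t))"
proof -
  let ?C = "\<lambda>u. integral {0..1} (\<lambda>t. k (u * turn t))"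
  have contk: "continuous_on S k" using hol by (rule holomorphic_on_imp_continuous_on)
  have cont': "continuous_on S (deriv k)"
    using holomorphic_deriv[OF hol S(1)] by (rule holomorphic_on_imp_continuous_on)
  have D: "(?C has_field_derivative 0) (at x)" if x: "x \<in> S" for x
  proof -
    obtain e where e: "e > 0" "ball x e \<subseteq> S" using S(1) x openE by blast
    have kd: "(k has_field_derivative deriv k y) (at y)" if "y \<in> S" for y
      using hol S(1) that by (rule holomorphic_derivI)
    have 1: "((\<lambda>u. integral (cbox 0 1) (\<lambda>t. k (u * turn t))) has_field_derivative
       integral (cbox 0 1) (\<lambda>t. deriv k (x * turn t) * turn t)) (at x within ball x e)"
    proof (rule leibniz_rule_field_derivative)
      fix y t assume "y \<in> ball x e"
      then have "y * turn t \<in> S" using e rot by blast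
      then show "((\<lambda>u. k (u * turn t)) has_field_derivative deriv k (y * turn t) * turn t) (at y within ball x e)"
        by (intro DERIV_chain2[OF kd] derivative_eq_intros) auto
    next
      fix y assume "y \<in> ball x e"
      then have "y * turn t \<in> S" for t using e rot by blast
      then show "(\<lambda>t. k (y * turn t)) integrable_on cbox 0 1"
        by (intro integrable_continuous continuous_on_compose2[OF contk] continuous_intros) auto
    next
      show "continuous_on (ball x e \<times> cbox 0 1) (\<lambda>(y, t). deriv k (y * turn t) * turn t)"
        unfolding split_beta using e rot
        by (intro continuous_intros continuous_on_compose2[OF cont']) auto
    qed (use e in auto)
    have "integral {0..1} (\<lambda>t. deriv k (x * turn t) * turn t) = 0"
    proof (cases "x = 0")
      case True
      have "((\<lambda>t. 2 * pi * \<i> * turn t) has_integral (turn 1 - turn 0)) {0..1}"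
        by (intro fundamental_theorem_of_calculus turn_has_vector_derivative) auto
      then have "((\<lambda>t. (2 * pi * \<i> * turn t) * (deriv k 0 / (2 * pi * \<i>))) has_integral
          0 * (deriv k 0 / (2 * pi * \<i>))) {0..1}"
        by (intro has_integral_mult_left) simp
      then have "((\<lambda>t. deriv k (x * turn t) * turn t) has_integral 0) {0..1}"
        by (rule has_integral_eq_rhs[OF has_integral_eq[rotated]]) (auto simp: True)
      then show ?thesis by (rule integral_unique)
    next
      case False
      have "((\<lambda>t. (2 * pi * \<i> * x) * (deriv k (x * turn t) * turn t)) has_integral
          (k (x * turn 1) - k (x * turn 0))) {0..1}"
      proof (intro fundamental_theorem_of_calculus)
        fix t
        have "((\<lambda>t. x * turn t) has_vector_derivative x * (2 * pi * \<i> * turn t)) (at t within {0..1})"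
          by (intro has_vector_derivative_mult_right turn_has_vector_derivative)
        from field_vector_diff_chain_within[OF this DERIV_subset[OF kd]] rot x
        show "((\<lambda>t. k (x * turn t)) has_vector_derivative
            2 * pi * \<i> * x * (deriv k (x * turn t) * turn t)) (at t within {0..1})"
          by (simp add: o_def mult_ac)
      qed simp
      then have "((\<lambda>t. (2 * pi * \<i> * x) * (deriv k (x * turn t) * turn t) / (2 * pi * \<i> * x)) has_integral
          0 / (2 * pi * \<i> * x)) {0..1}"
        by (intro has_integral_divide) simp
      moreover have "(\<lambda>t. (2 * pi * \<i> * x) * (deriv k (x * turn t) * turn t) / (2 * pi * \<i> * x)) =
          (\<lambda>t. deriv k (x * turn t) * turn t)"
        using False by simp
      ultimately show ?thesis by (simp add: integral_unique)
    qed
    with 1 e show ?thesis by (simp add: at_within_open[of x "ball x e"])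
  qed
  obtain c where "\<And>x. x \<in> S \<Longrightarrow> ?C x = c"
    using has_field_derivative_0_imp_constant_on[OF D S(2,1)] unfolding constant_on_def by blast
  then show ?thesis using u v by simp
qed

section \<open>Holomorphic functions of two variables\<close>

definition cscale :: "complex \<Rightarrow> complex \<times> complex \<Rightarrow> complex \<times> complex"
  where "cscale c w = (c * fst w, c * snd w)"

lemma fst_cscale [simp]: "fst (cscale c w) = c * fst w"
  and snd_cscale [simp]: "snd (cscale c w) = c * snd w"
  by (simp_all add: cscale_def)

lemma cscale_simps [simp]: "cscale 0 w = 0" "cscale 1 w = w" "cscale c 0 = 0"
  by (simp_all add: prod_eq_iff)

lemma norm_cscale [simp]: "norm (cscale c w) = cmod c * norm w"
  by (simp add: cscale_def norm_Pair norm_prod_def norm_mult power_mult_distrib real_sqrt_mult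
      flip: distrib_left)

lemma linear_cscale: "linear (cscale c)"
  by (intro linearI) (auto simp: cscale_def prod_eq_iff algebra_simps)

lemma continuous_on_cscale [continuous_intros]:
  "continuous_on S f \<Longrightarrow> continuous_on S g \<Longrightarrow> continuous_on S (\<lambda>x. cscale (f x) (g x))"
  unfolding cscale_def by (intro continuous_intros)

lemma holomorphic2_on_derivative:
  assumes "f holomorphic2_on \<Omega>" "open \<Omega>" "z \<in> \<Omega>"
  obtains a b where "(f has_derivative (\<lambda>h. a * fst h + b * snd h)) (at z)"
  using assms by (auto simp: holomorphic2_on_def at_within_open[of _ \<Omega>])

lemma holomorphic2_on_imp_continuous_on:
  assumes "f holomorphic2_on \<Omega>" shows "continuous_on \<Omega> f"
  using assms unfolding holomorphic2_on_def continuous_on_eq_continuous_within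
  by (blast intro: has_derivative_continuous)

lemma holomorphic2_on_const: "(\<lambda>z. c) holomorphic2_on \<Omega>"
  unfolding holomorphic2_on_def by (auto intro!: exI[of _ 0] derivative_eq_intros)

lemma holomorphic2_on_add:
  assumes "f holomorphic2_on \<Omega>" "g holomorphic2_on \<Omega>"
  shows "(\<lambda>z. f z + g z) holomorphic2_on \<Omega>"
  unfolding holomorphic2_on_def
proof
  fix z assume "z \<in> \<Omega>"
  then obtain a b c d where
    "(f has_derivative (\<lambda>h. a * fst h + b * snd h)) (at z within \<Omega>)"
    "(g has_derivative (\<lambda>h. c * fst h + d * snd h)) (at z within \<Omega>)"
    using assms unfolding holomorphic2_on_def by blast
  from has_derivative_add[OF this]
  have "((\<lambda>z. f z + g z) has_derivative (\<lambda>h. (a + c) * fst h + (b + d) * snd h)) (at z within \<Omega>)"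
    by (simp add: algebra_simps)
  then show "\<exists>a b. ((\<lambda>z. f z + g z) has_derivative (\<lambda>h. a * fst h + b * snd h)) (at z within \<Omega>)"
    by blast
qed

lemma holomorphic2_on_mult:
  assumes "f holomorphic2_on \<Omega>" "g holomorphic2_on \<Omega>"
  shows "(\<lambda>z. f z * g z) holomorphic2_on \<Omega>"
  unfolding holomorphic2_on_def
proof
  fix z assume "z \<in> \<Omega>"
  then obtain a b c d where
    "(f has_derivative (\<lambda>h. a * fst h + b * snd h)) (at z within \<Omega>)"
    "(g has_derivative (\<lambda>h. c * fst h + d * snd h)) (at z within \<Omega>)"
    using assms unfolding holomorphic2_on_def by blast
  from has_derivative_mult[OF this]
  have "((\<lambda>z. f z * g z) has_derivative
      (\<lambda>h. (f z * c + a * g z) * fst h + (f z * d + b * g z) * snd h)) (at z within \<Omega>)"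
    by (simp add: algebra_simps)
  then show "\<exists>a b. ((\<lambda>z. f z * g z) has_derivative (\<lambda>h. a * fst h + b * snd h)) (at z within \<Omega>)"
    by blast
qed

lemma holomorphic2_on_cmult:
  "f holomorphic2_on \<Omega> \<Longrightarrow> (\<lambda>z. c * f z) holomorphic2_on \<Omega>"
  by (rule holomorphic2_on_mult[OF holomorphic2_on_const])

lemma holomorphic2_on_diff:
  "f holomorphic2_on \<Omega> \<Longrightarrow> g holomorphic2_on \<Omega> \<Longrightarrow> (\<lambda>z. f z - g z) holomorphic2_on \<Omega>"
  using holomorphic2_on_add[of f \<Omega> "\<lambda>z. - 1 * g z"] holomorphic2_on_cmult[of g \<Omega> "- 1"] by simp

lemma holomorphic2_on_compose_fst:
  assumes k: "k holomorphic_on S" "open S" and sub: "\<And>z. z \<in> \<Omega> \<Longrightarrow> fst z \<in> S"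
  shows "(\<lambda>z. k (fst z)) holomorphic2_on \<Omega>"
  unfolding holomorphic2_on_def
proof
  fix z assume "z \<in> \<Omega>"
  then have "(k has_derivative (\<lambda>h. deriv k (fst z) * h)) (at (fst z))"
    using holomorphic_derivI[OF k] sub by (simp add: has_field_derivative_def)
  then have "((\<lambda>z. k (fst z)) has_derivative (\<lambda>h. deriv k (fst z) * fst h)) (at z within \<Omega>)"
    by (rule has_derivative_compose[rotated]) (auto intro!: derivative_eq_intros)
  then have "((\<lambda>z. k (fst z)) has_derivative (\<lambda>h. deriv k (fst z) * fst h + 0 * snd h)) (at z within \<Omega>)"
    by simp
  then show "\<exists>a b. ((\<lambda>z. k (fst z)) has_derivative (\<lambda>h. a * fst h + b * snd h)) (at z within \<Omega>)"
    by blast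
qed

text \<open>Restricting to complex lines through a point reduces statements in two variables to
  one-variable function theory.\<close>

lemma has_field_derivative_line:
  assumes "(f has_derivative (\<lambda>h. a * fst h + b * snd h)) (at (z + cscale \<zeta> w))"
  shows "((\<lambda>\<zeta>. f (z + cscale \<zeta> w)) has_field_derivative (a * fst w + b * snd w)) (at \<zeta>)"
proof -
  have "((\<lambda>\<zeta>. z + cscale \<zeta> w) has_derivative (\<lambda>h. cscale h w)) (at \<zeta>)"
    unfolding cscale_def by (auto intro!: derivative_eq_intros simp: prod_eq_iff)
  from has_derivative_compose[OF this assms] show ?thesis
    unfolding has_field_derivative_def by (rule has_derivative_eq_rhs) (simp add: fun_eq_iff algebra_simps)
qed

lemma holomorphic2_on_line:
  assumes "f holomorphic2_on \<Omega>" "open \<Omega>" "\<And>\<zeta>. \<zeta> \<in> S \<Longrightarrow> z + cscale \<zeta> w \<in> \<Omega>"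
  shows "(\<lambda>\<zeta>. f (z + cscale \<zeta> w)) holomorphic_on S"
  unfolding holomorphic_on_def
proof
  fix \<zeta> assume "\<zeta> \<in> S"
  then obtain a b where "(f has_derivative (\<lambda>h. a * fst h + b * snd h)) (at (z + cscale \<zeta> w))"
    using assms holomorphic2_on_derivative by blast
  from has_field_derivative_line[OF this]
  show "(\<lambda>\<zeta>. f (z + cscale \<zeta> w)) field_differentiable at \<zeta> within S"
    using field_differentiable_at_within field_differentiable_def by blast
qed

text \<open>Cauchy's inequality on the disc of radius \<open>r / norm h\<close> in the line through \<open>z\<close> in direction \<open>h\<close>.\<close>

lemma holomorphic2_derivative_bound:
  assumes f: "f holomorphic2_on \<Omega>" "open \<Omega>" and r: "r > 0" "cball z r \<subseteq> \<Omega>"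
    and D: "(f has_derivative (\<lambda>h. a * fst h + b * snd h)) (at z)"
    and B: "\<And>x. x \<in> cball z r \<Longrightarrow> cmod (f x) \<le> B"
  shows "cmod (a * fst h + b * snd h) \<le> B / r * norm h"
proof (cases "h = 0")
  case False
  define \<rho> where "\<rho> = r / norm h"
  have \<rho>: "\<rho> > 0" using False r by (simp add: \<rho>_def)
  let ?g = "\<lambda>\<zeta>. f (z + cscale \<zeta> h)"
  have in_ball: "z + cscale \<zeta> h \<in> cball z r" if "cmod \<zeta> \<le> \<rho>" for \<zeta>
    using that False by (simp add: \<rho>_def dist_norm field_simps)
  have hol: "?g holomorphic_on cball 0 \<rho>"
    using in_ball r by (intro holomorphic2_on_line[OF f]) auto
  have "cmod ((deriv ^^ 1) ?g 0) \<le> fact 1 * B / \<rho> ^ 1"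
  proof (rule Cauchy_inequality[OF _ _ \<rho>])
    show "?g holomorphic_on ball 0 \<rho>" using hol by (rule holomorphic_on_subset) auto
    show "continuous_on (cball 0 \<rho>) ?g" using hol by (rule holomorphic_on_imp_continuous_on)
    show "cmod (?g x) \<le> B" if "cmod (0 - x) = \<rho>" for x
      using that by (intro B in_ball) simp
  qed
  moreover have "deriv ?g 0 = a * fst h + b * snd h"
    by (rule DERIV_imp_deriv, rule has_field_derivative_line) (use D in simp)
  ultimately show ?thesis using False by (simp add: \<rho>_def)
qed simp

lemma holomorphic2_circle_mean:
  assumes f: "f holomorphic2_on \<Omega>" "open \<Omega>" and sub: "ball z r \<subseteq> \<Omega>" and w: "norm w < r"
  shows "integral {0..1} (\<lambda>t. f (z + cscale (turn t) w)) = f z"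
proof -
  define S where "S = {\<zeta>. cmod \<zeta> * norm w < r}"
  have r: "r > 0" using w norm_ge_zero[of w] by linarith
  have S: "open S" "connected S"
  proof -
    have "S = (if w = 0 then UNIV else ball 0 (r / norm w))"
      using r by (auto simp: S_def field_simps)
    then show "open S" "connected S" by auto
  qed
  have "integral {0..1} (\<lambda>t. f (z + cscale (1 * turn t) w)) =
      integral {0..1} (\<lambda>t. f (z + cscale (0 * turn t) w))"
  proof (rule rotation_mean_constant[OF _ S])
    show "(\<lambda>\<zeta>. f (z + cscale \<zeta> w)) holomorphic_on S"
      using sub by (intro holomorphic2_on_line[OF f]) (auto simp: S_def dist_norm)
  qed (use w r in \<open>auto simp: S_def norm_mult\<close>)
  then show ?thesis by simp
qed

text \<open>Rotating \<open>w\<close> in its complex line maps \<open>ball 0 r\<close> to itself and averages \<open>f (z + w)\<close> to \<open>f z\<close>.\<close>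

lemma holomorphic2_ball_mean:
  assumes f: "f holomorphic2_on \<Omega>" "open \<Omega>" and sub: "ball z r \<subseteq> \<Omega>"
    and int: "set_integrable lborel (ball z r) f"
  shows "(\<integral>x. indicator (ball z r) x *\<^sub>R f x \<partial>lborel) = measure lborel (ball z r) *\<^sub>R f z"
proof -
  let ?F = "\<lambda>x. indicator (ball z r) x *\<^sub>R f x"
  define G where "G w = ?F (z + w)" for w
  have contf: "continuous_on (ball z r) f"
    using holomorphic2_on_imp_continuous_on[OF f(1)] sub by (rule continuous_on_subset)
  have Fm[measurable]: "?F \<in> borel_measurable borel"
    by (intro borel_measurable_continuous_on_indicator contf) auto
  have Gm[measurable]: "G \<in> borel_measurable borel" unfolding G_def by measurable
  have eq: "lborel = distr lborel borel ((+) z)" by (rule lborel_distr_plus[symmetric])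
  have "integrable (distr lborel borel ((+) z)) ?F"
    using int lborel_distr_plus[of z] by (simp add: set_integrable_def)
  then have Gi: "integrable lborel G"
    by (subst (asm) integrable_distr_eq) (auto simp: G_def[abs_def])
  have GF: "(\<integral>w. G w \<partial>lborel) = (\<integral>x. ?F x \<partial>lborel)"
    by (subst (2) eq, subst integral_distr) (auto simp: G_def[abs_def])
  have avg: "integral {0..1} (\<lambda>t. G (cscale (turn t) w)) = indicator (ball 0 r) w *\<^sub>R f z" for w
  proof (cases "norm w < r")
    case True
    have "G (cscale (turn t) w) = f (z + cscale (turn t) w)" for t
      using True by (simp add: G_def dist_norm)
    with True show ?thesis using holomorphic2_circle_mean[OF f sub True] by simp
  next
    case False
    then have "G (cscale (turn t) w) = 0" for t by (simp add: G_def dist_norm)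
    with False show ?thesis by simp
  qed
  have "(\<integral>w. G w \<partial>lborel) = (\<integral>w. integral {0..1} (\<lambda>t. G (cscale (turn t) w)) \<partial>lborel)"
  proof (rule integral_lborel_average(2)[symmetric, OF Gi Gm])
    show "(\<lambda>(t, w). cscale (turn t) w) \<in> borel_measurable (borel \<Otimes>\<^sub>M borel)"
      unfolding borel_prod split_beta
      by (intro borel_measurable_continuous_onI continuous_intros)
    show "continuous_on {0..1} (\<lambda>t. G (cscale (turn t) w))" for w
    proof (cases "norm w < r")
      case True
      have "G (cscale (turn t) w) = f (z + cscale (turn t) w)" for t
        using True by (simp add: G_def dist_norm)
      then show ?thesis using True
        by (auto intro!: continuous_on_compose2[OF contf] continuous_intros simp: dist_norm)
    next
      case False
      then have "G (cscale (turn t) w) = 0" for t by (simp add: G_def dist_norm)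
      then show ?thesis by simp
    qed
  qed (simp_all add: linear_cscale)
  also have "\<dots> = (\<integral>w. indicator (ball 0 r) (w :: complex \<times> complex) *\<^sub>R f z \<partial>lborel)" by (simp only: avg)
  also have "\<dots> = measure lborel (ball (0 :: complex \<times> complex) r) *\<^sub>R f z"
    by (subst integral_scaleR_left)
       (auto intro!: integrable_real_indicator emeasure_lborel_ball_finite simp: less_top[symmetric])
  also have "measure lborel (ball (0 :: complex \<times> complex) r) = measure lborel (ball z r)"
  proof (cases "r \<ge> 0")
    case True
    then show ?thesis by (simp add: content_ball)
  qed (simp add: ball_empty)
  finally show ?thesis by (simp add: GF)
qed

text \<open>On a smaller ball the Cauchy estimate controls the derivatives of \<open>f n - f m\<close>, so the
  derivatives converge uniformly too. Hence the limit is differentiable, and its derivative, a limit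
  of complex linear maps, is complex linear.\<close>

lemma holomorphic2_on_locally_uniform_limit:
  assumes \<Omega>: "open \<Omega>" and f: "\<And>n. f n holomorphic2_on \<Omega>"
    and cauchy: "\<And>z. z \<in> \<Omega> \<Longrightarrow> \<exists>r>0. ball z r \<subseteq> \<Omega> \<and> uniformly_Cauchy_on (ball z r) f"
  shows "(\<lambda>z. lim (\<lambda>n. f n z)) holomorphic2_on \<Omega>"
    and "\<And>z. z \<in> \<Omega> \<Longrightarrow> (\<lambda>n. f n z) \<longlonglongrightarrow> lim (\<lambda>n. f n z)"
proof -
  have conv: "(\<lambda>n. f n z) \<longlonglongrightarrow> lim (\<lambda>n. f n z)" if z: "z \<in> \<Omega>" for z
  proof -
    obtain r where "r > 0" "uniformly_Cauchy_on (ball z r) f" using cauchy[OF z] by blast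
    then have "Cauchy (\<lambda>n. f n z)"
      unfolding uniformly_Cauchy_on_def Cauchy_def by (meson centre_in_ball)
    then show ?thesis by (simp add: Cauchy_convergent convergent_LIMSEQ_iff[symmetric])
  qed
  show "\<And>z. z \<in> \<Omega> \<Longrightarrow> (\<lambda>n. f n z) \<longlonglongrightarrow> lim (\<lambda>n. f n z)" by (rule conv)
  show "(\<lambda>z. lim (\<lambda>n. f n z)) holomorphic2_on \<Omega>"
    unfolding holomorphic2_on_def
  proof
    fix z assume z: "z \<in> \<Omega>"
    obtain r where r: "r > 0" "ball z r \<subseteq> \<Omega>" and uc: "uniformly_Cauchy_on (ball z r) f"
      using cauchy[OF z] by blast
    have "\<exists>c. (f n has_derivative (\<lambda>h. fst c * fst h + snd c * snd h)) (at x)" if "x \<in> \<Omega>" for n x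
      using holomorphic2_on_derivative[OF f \<Omega> that, of n] by (metis fst_conv snd_conv)
    then have "\<forall>n x. \<exists>c. x \<in> \<Omega> \<longrightarrow> (f n has_derivative (\<lambda>h. fst c * fst h + snd c * snd h)) (at x)"
      by blast
    then obtain c where c: "\<And>n x. x \<in> \<Omega> \<Longrightarrow>
        (f n has_derivative (\<lambda>h. fst (c n x) * fst h + snd (c n x) * snd h)) (at x)"
      unfolding choice_iff by blast
    define a where "a n x = fst (c n x)" for n x
    define b where "b n x = snd (c n x)" for n x
    have ab: "\<And>n x. x \<in> \<Omega> \<Longrightarrow>
        (f n has_derivative (\<lambda>h. a n x * fst h + b n x * snd h)) (at x)"
      using c by (simp add: a_def b_def)
    let ?S = "ball z (r / 2)"
    have zS: "z \<in> ?S" using r by simp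
    have sub: "cball x (r / 2) \<subseteq> ball z r" if "x \<in> ?S" for x
    proof
      fix y assume "y \<in> cball x (r / 2)"
      with that show "y \<in> ball z r" using dist_triangle[of z y x] by simp
    qed
    have S\<Omega>: "x \<in> \<Omega>" if "x \<in> ?S" for x
      using that r by (auto intro: subsetD[OF r(2)])
    have diff: "cmod ((a n x * fst h + b n x * snd h) - (a m x * fst h + b m x * snd h)) \<le> e / (r / 2) * norm h"
      if x: "x \<in> ?S" and e: "\<And>y. y \<in> ball z r \<Longrightarrow> dist (f n y) (f m y) < e" for n m x h e
    proof -
      have "cmod ((a n x - a m x) * fst h + (b n x - b m x) * snd h) \<le> e / (r / 2) * norm h"
      proof (rule holomorphic2_derivative_bound[OF holomorphic2_on_diff[OF f[of n] f[of m]] \<Omega>])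
        show "((\<lambda>z. f n z - f m z) has_derivative
            (\<lambda>h. (a n x - a m x) * fst h + (b n x - b m x) * snd h)) (at x)"
          using has_derivative_diff[OF ab[OF S\<Omega>[OF x], of n] ab[OF S\<Omega>[OF x], of m]]
          by (simp add: algebra_simps)
        show "cball x (r / 2) \<subseteq> \<Omega>" using sub[OF x] r by blast
        show "cmod (f n y - f m y) \<le> e" if "y \<in> cball x (r / 2)" for y
          using e[of y] sub[OF x] that by (auto simp: dist_norm less_imp_le)
      qed (use r in simp)
      then show ?thesis by (simp add: algebra_simps)
    qed
    have unif: "\<exists>N. \<forall>n\<ge>N. \<forall>m\<ge>N. \<forall>x\<in>?S. \<forall>h.
        cmod ((a n x * fst h + b n x * snd h) - (a m x * fst h + b m x * snd h)) \<le> e * norm h"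
      if e: "e > 0" for e
    proof -
      have "e * (r / 2) > 0" using e r by simp
      with uc obtain N where N: "\<And>y m n. y \<in> ball z r \<Longrightarrow> m \<ge> N \<Longrightarrow> n \<ge> N \<Longrightarrow> dist (f m y) (f n y) < e * (r / 2)"
        unfolding uniformly_Cauchy_on_def by metis
      show ?thesis
      proof (intro exI[of _ N] allI impI ballI)
        fix n m x h assume "N \<le> n" "N \<le> m" "x \<in> ?S"
        with diff[of x n m "e * (r / 2)" h] N r
        show "cmod ((a n x * fst h + b n x * snd h) - (a m x * fst h + b m x * snd h)) \<le> e * norm h"
          by simp
      qed
    qed
    have Cab: "Cauchy (\<lambda>n. a n x * fst h + b n x * snd h)" if x: "x \<in> ?S" for x h
    proof (rule CauchyI)
      fix e :: real assume e: "e > 0"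
      have e': "e / (norm h + 1) > 0" using e by (simp add: add_nonneg_pos)
      have lt: "e / (norm h + 1) * norm h < e" using e mult_strict_left_mono[OF _ e, of "norm h" "norm h + 1"] by (simp add: divide_less_eq add_nonneg_pos)
      from unif[OF e'] x lt show "\<exists>M. \<forall>m\<ge>M. \<forall>n\<ge>M.
          cmod (a m x * fst h + b m x * snd h - (a n x * fst h + b n x * snd h)) < e"
        by (meson le_less_trans)
    qed
    define a' where "a' x = lim (\<lambda>n. a n x)" for x
    define b' where "b' x = lim (\<lambda>n. b n x)" for x
    have lima: "(\<lambda>n. a n x) \<longlonglongrightarrow> a' x" and limb: "(\<lambda>n. b n x) \<longlonglongrightarrow> b' x" if "x \<in> ?S" for x
      using Cab[OF that, of "(1, 0)"] Cab[OF that, of "(0, 1)"]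
      by (simp_all add: a'_def b'_def Cauchy_convergent_iff convergent_LIMSEQ_iff)
    have "\<exists>g. \<forall>x\<in>?S. (\<lambda>n. f n x) \<longlonglongrightarrow> g x \<and>
        (g has_derivative (\<lambda>h. a' x * fst h + b' x * snd h)) (at x within ?S)"
    proof (rule has_derivative_sequence[where f = f and S = "?S", OF _ _ _ zS conv[OF z]])
      show "(f n has_derivative (\<lambda>h. a n x * fst h + b n x * snd h)) (at x within ?S)" if "x \<in> ?S" for n x
        using ab[OF S\<Omega>[OF that]] by (rule has_derivative_at_withinI)
      fix e :: real assume "e > 0"
      from unif[OF this] obtain N where N: "\<And>n m x h. n \<ge> N \<Longrightarrow> m \<ge> N \<Longrightarrow> x \<in> ?S \<Longrightarrow>
          cmod ((a n x * fst h + b n x * snd h) - (a m x * fst h + b m x * snd h)) \<le> e * norm h"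
        by blast
      show "\<forall>\<^sub>F n in sequentially. \<forall>x\<in>?S. \<forall>h.
          cmod (a n x * fst h + b n x * snd h - (a' x * fst h + b' x * snd h)) \<le> e * norm h"
        unfolding eventually_sequentially
      proof (intro exI[of _ N] allI impI ballI)
        fix n x h assume n: "N \<le> n" and x: "x \<in> ?S"
        have lim: "(\<lambda>m. cmod (a n x * fst h + b n x * snd h - (a m x * fst h + b m x * snd h))) \<longlonglongrightarrow>
            cmod (a n x * fst h + b n x * snd h - (a' x * fst h + b' x * snd h))"
          by (intro tendsto_intros lima[OF x] limb[OF x])
        show "cmod (a n x * fst h + b n x * snd h - (a' x * fst h + b' x * snd h)) \<le> e * norm h"
          by (rule LIMSEQ_le_const2[OF lim]) (use N n x in blast)
      qed
    qed (use r in auto)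
    then obtain g where g: "\<And>x. x \<in> ?S \<Longrightarrow> (\<lambda>n. f n x) \<longlonglongrightarrow> g x"
      "\<And>x. x \<in> ?S \<Longrightarrow> (g has_derivative (\<lambda>h. a' x * fst h + b' x * snd h)) (at x within ?S)"
      by blast
    have "(g has_derivative (\<lambda>h. a' z * fst h + b' z * snd h)) (at z)"
      using g(2)[OF zS] at_within_open[OF zS] by simp
    then have "((\<lambda>z. lim (\<lambda>n. f n z)) has_derivative (\<lambda>h. a' z * fst h + b' z * snd h)) (at z)"
    proof (rule has_derivative_transform_within_open[OF _ open_ball zS])
      show "g x = lim (\<lambda>n. f n x)" if "x \<in> ?S" for x using limI[OF g(1)[OF that]] by simp
    qed
    then show "\<exists>a b. ((\<lambda>z. lim (\<lambda>n. f n z)) has_derivative (\<lambda>h. a * fst h + b * snd h)) (at z within \<Omega>)"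
      using has_derivative_at_withinI by blast
  qed
qed

section \<open>Weighted Bergman spaces and the orthogonal projection\<close>

lemma cmod_add_power2: "(cmod (x + y))\<^sup>2 = (cmod x)\<^sup>2 + (cmod y)\<^sup>2 + 2 * Re (x * cnj y)"
  unfolding cmod_power2 by (simp add: power2_eq_square algebra_simps)

lemma cmod_diff_power2: "(cmod (x - y))\<^sup>2 = (cmod x)\<^sup>2 + (cmod y)\<^sup>2 - 2 * Re (x * cnj y)"
  unfolding cmod_power2 by (simp add: power2_eq_square algebra_simps)

locale weighted_domain =
  fixes \<Omega> :: "(complex \<times> complex) set" and \<mu> :: "complex \<times> complex \<Rightarrow> real"
  assumes open_domain: "open \<Omega>"
    and continuous_weight: "continuous_on \<Omega> \<mu>"
    and weight_pos: "\<And>z. z \<in> \<Omega> \<Longrightarrow> \<mu> z > 0"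
begin

abbreviation W where "W \<equiv> weighted_measure \<Omega> \<mu>"

lemma domain_sets [measurable, simp]: "\<Omega> \<in> sets borel" "\<Omega> \<in> sets lebesgue"
  using open_domain by (auto intro: lmeasurable_open)

lemma space_W [simp]: "space W = \<Omega>"
  by (simp add: weighted_measure_def)

lemma sets_W [measurable_cong]: "sets W = sets (lebesgue_on \<Omega>)"
  by (simp add: weighted_measure_def)

lemma continuous_imp_measurable_W:
  fixes f :: "complex \<times> complex \<Rightarrow> 'b::euclidean_space"
  assumes "continuous_on \<Omega> f" shows "f \<in> borel_measurable W"
  using continuous_imp_measurable_on_sets_lebesgue[OF assms]
  by (simp cong: measurable_cong_sets[OF sets_W refl])

lemma weight_measurable [measurable]: "\<mu> \<in> borel_measurable (lebesgue_on \<Omega>)"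
  by (rule continuous_imp_measurable_on_sets_lebesgue[OF continuous_weight]) simp

text \<open>Invariance under rotations and Fubini's theorem are available for Borel functions on the whole
  space, whereas \<^const>\<open>weighted_measure\<close> is a density on a restricted completion. Functions
  continuous on \<open>\<Omega>\<close> can be moved between the two settings.\<close>

lemma
  fixes f :: "complex \<times> complex \<Rightarrow> 'b::euclidean_space"
  assumes f: "continuous_on \<Omega> f"
  shows integrable_W_iff: "integrable W f \<longleftrightarrow> integrable lborel (\<lambda>z. indicator \<Omega> z *\<^sub>R (\<mu> z *\<^sub>R f z))"
    and integral_W: "(\<integral>z. f z \<partial>W) = (\<integral>z. indicator \<Omega> z *\<^sub>R (\<mu> z *\<^sub>R f z) \<partial>lborel)"
    and measurable_extend: "(\<lambda>z. indicator \<Omega> z *\<^sub>R (\<mu> z *\<^sub>R f z)) \<in> borel_measurable borel"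
proof -
  have f': "f \<in> borel_measurable (lebesgue_on \<Omega>)"
    by (rule continuous_imp_measurable_on_sets_lebesgue[OF f]) simp
  have pos: "AE z in lebesgue_on \<Omega>. 0 \<le> \<mu> z"
    using weight_pos by (intro AE_I2) (auto simp: less_imp_le)
  show m: "(\<lambda>z. indicator \<Omega> z *\<^sub>R (\<mu> z *\<^sub>R f z)) \<in> borel_measurable borel"
    by (intro borel_measurable_continuous_on_indicator continuous_intros continuous_weight f) auto
  show "integrable W f \<longleftrightarrow> integrable lborel (\<lambda>z. indicator \<Omega> z *\<^sub>R (\<mu> z *\<^sub>R f z))"
    unfolding weighted_measure_def
    using m by (simp add: integrable_density[OF f' weight_measurable pos] integrable_restrict_space
        integrable_completion)
  show "(\<integral>z. f z \<partial>W) = (\<integral>z. indicator \<Omega> z *\<^sub>R (\<mu> z *\<^sub>R f z) \<partial>lborel)"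
    unfolding weighted_measure_def
    using m by (simp add: integral_density[OF f' weight_measurable pos] integral_restrict_space
        integral_completion)
qed

lemma Lp_space_iff:
  "f \<in> Lp_space p \<Omega> \<mu> \<longleftrightarrow> f \<in> borel_measurable W \<and> integrable W (\<lambda>z. cmod (f z) powr p)"
  unfolding Lp_space_def by (auto simp: integrable_iff_bounded)

lemma L2_space_iff:
  "f \<in> Lp_space 2 \<Omega> \<mu> \<longleftrightarrow> f \<in> borel_measurable W \<and> integrable W (\<lambda>z. (cmod (f z))\<^sup>2)"
  by (simp add: Lp_space_iff)

lemma L2_measurable: "f \<in> Lp_space 2 \<Omega> \<mu> \<Longrightarrow> f \<in> borel_measurable W"
  by (simp add: L2_space_iff)

lemma L2_integrable: "f \<in> Lp_space 2 \<Omega> \<mu> \<Longrightarrow> integrable W (\<lambda>z. (cmod (f z))\<^sup>2)"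
  by (simp add: L2_space_iff)

lemma L2_inner_integrable:
  assumes "f \<in> Lp_space 2 \<Omega> \<mu>" "g \<in> Lp_space 2 \<Omega> \<mu>"
  shows "integrable W (\<lambda>z. f z * cnj (g z))"
proof (rule Bochner_Integration.integrable_bound)
  show "integrable W (\<lambda>z. (cmod (f z))\<^sup>2 + (cmod (g z))\<^sup>2)"
    using assms by (simp add: L2_integrable)
  show "(\<lambda>z. f z * cnj (g z)) \<in> borel_measurable W"
    using assms[THEN L2_measurable]
    by (intro borel_measurable_times borel_measurable_continuous_on[where f = cnj] continuous_intros)
  have "a * b \<le> a\<^sup>2 + b\<^sup>2" if "a \<ge> 0" "b \<ge> 0" for a b :: real
    using sum_squares_bound[of a b] mult_nonneg_nonneg[OF that] by linarith
  then show "AE z in W. norm (f z * cnj (g z)) \<le> norm ((cmod (f z))\<^sup>2 + (cmod (g z))\<^sup>2)"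
    by (simp add: norm_mult)
qed

lemma L2_add:
  assumes "f \<in> Lp_space 2 \<Omega> \<mu>" "g \<in> Lp_space 2 \<Omega> \<mu>"
  shows "(\<lambda>z. f z + g z) \<in> Lp_space 2 \<Omega> \<mu>"
  unfolding L2_space_iff
proof
  show "(\<lambda>z. f z + g z) \<in> borel_measurable W"
    using assms[THEN L2_measurable] by measurable
  have "integrable W (\<lambda>z. (cmod (f z))\<^sup>2 + (cmod (g z))\<^sup>2 + 2 * Re (f z * cnj (g z)))"
    by (intro Bochner_Integration.integrable_add integrable_mult_right integrable_Re
        L2_integrable L2_inner_integrable assms)
  then show "integrable W (\<lambda>z. (cmod (f z + g z))\<^sup>2)"
    by (simp only: cmod_add_power2)
qed

lemma L2_cmult: "f \<in> Lp_space 2 \<Omega> \<mu> \<Longrightarrow> (\<lambda>z. c * f z) \<in> Lp_space 2 \<Omega> \<mu>"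
  by (auto simp: L2_space_iff norm_mult power_mult_distrib)

lemma L2_diff:
  "f \<in> Lp_space 2 \<Omega> \<mu> \<Longrightarrow> g \<in> Lp_space 2 \<Omega> \<mu> \<Longrightarrow> (\<lambda>z. f z - g z) \<in> Lp_space 2 \<Omega> \<mu>"
  using L2_add[of f "\<lambda>z. - 1 * g z"] L2_cmult[of g "- 1"] by simp

definition sqnorm :: "(complex \<times> complex \<Rightarrow> complex) \<Rightarrow> real"
  where "sqnorm f = (\<integral>z. (cmod (f z))\<^sup>2 \<partial>W)"

lemma sqnorm_nonneg [simp]: "sqnorm f \<ge> 0"
  by (simp add: sqnorm_def)

lemma sqnorm_minus_multiple:
  assumes f: "f \<in> Lp_space 2 \<Omega> \<mu>" and g: "g \<in> Lp_space 2 \<Omega> \<mu>"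
  shows "sqnorm (\<lambda>z. f z - c * g z) =
    sqnorm f - 2 * Re (cnj c * L2_inner \<Omega> \<mu> f g) + (cmod c)\<^sup>2 * sqnorm g"
proof -
  have i: "integrable W (\<lambda>z. cnj c * (f z * cnj (g z)))"
    using L2_inner_integrable[OF f g] by simp
  have eq: "(cmod (f z - c * g z))\<^sup>2 =
      (cmod (f z))\<^sup>2 - 2 * Re (cnj c * (f z * cnj (g z))) + (cmod c)\<^sup>2 * (cmod (g z))\<^sup>2" for z
  proof -
    have "f z * cnj (c * g z) = cnj c * (f z * cnj (g z))" by simp
    then show ?thesis unfolding cmod_diff_power2 by (simp only: norm_mult power_mult_distrib)
  qed
  define R where "R z = Re (cnj c * (f z * cnj (g z)))" for z
  have R: "integrable W R" unfolding R_def by (rule integrable_Re[OF i])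
  have "sqnorm (\<lambda>z. f z - c * g z) = sqnorm f - 2 * (\<integral>z. R z \<partial>W) + (cmod c)\<^sup>2 * sqnorm g"
    unfolding sqnorm_def eq R_def[symmetric] using L2_integrable[OF f] L2_integrable[OF g] R by simp
  also have "(\<integral>z. R z \<partial>W) = Re (cnj c * L2_inner \<Omega> \<mu> f g)"
    unfolding R_def using i by (simp only: integral_Re L2_inner_def integral_mult_right_zero)
  finally show ?thesis .
qed

lemma sqnorm_parallelogram:
  assumes f: "f \<in> Lp_space 2 \<Omega> \<mu>" and g: "g \<in> Lp_space 2 \<Omega> \<mu>"
  shows "sqnorm (\<lambda>z. f z - g z) + sqnorm (\<lambda>z. f z + g z) = 2 * sqnorm f + 2 * sqnorm g"
  using sqnorm_minus_multiple[OF f g, of 1] sqnorm_minus_multiple[OF f g, of "- 1"] by simp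

lemma sqnorm_cmult: "sqnorm (\<lambda>z. c * f z) = (cmod c)\<^sup>2 * sqnorm f"
  by (simp add: sqnorm_def norm_mult power_mult_distrib)

lemma L2_inner_diff_left:
  assumes "f \<in> Lp_space 2 \<Omega> \<mu>" "g \<in> Lp_space 2 \<Omega> \<mu>" "h \<in> Lp_space 2 \<Omega> \<mu>"
  shows "L2_inner \<Omega> \<mu> (\<lambda>z. f z - g z) h = L2_inner \<Omega> \<mu> f h - L2_inner \<Omega> \<mu> g h"
  using assms by (simp add: L2_inner_def left_diff_distrib L2_inner_integrable)

lemma L2_inner_self: "L2_inner \<Omega> \<mu> f f = of_real (sqnorm f)"
  by (simp add: L2_inner_def sqnorm_def complex_norm_square[symmetric] flip: integral_complex_of_real)

lemma bergman_L2: "h \<in> bergman_space \<Omega> \<mu> \<Longrightarrow> h \<in> Lp_space 2 \<Omega> \<mu>"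
  and bergman_holomorphic: "h \<in> bergman_space \<Omega> \<mu> \<Longrightarrow> h holomorphic2_on \<Omega>"
  by (simp_all add: bergman_space_def)

lemma bergman_add:
  "g \<in> bergman_space \<Omega> \<mu> \<Longrightarrow> h \<in> bergman_space \<Omega> \<mu> \<Longrightarrow> (\<lambda>z. g z + h z) \<in> bergman_space \<Omega> \<mu>"
  by (simp add: bergman_space_def L2_add holomorphic2_on_add)

lemma bergman_diff:
  "g \<in> bergman_space \<Omega> \<mu> \<Longrightarrow> h \<in> bergman_space \<Omega> \<mu> \<Longrightarrow> (\<lambda>z. g z - h z) \<in> bergman_space \<Omega> \<mu>"
  by (simp add: bergman_space_def L2_diff holomorphic2_on_diff)

lemma bergman_cmult: "h \<in> bergman_space \<Omega> \<mu> \<Longrightarrow> (\<lambda>z. c * h z) \<in> bergman_space \<Omega> \<mu>"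
  by (simp add: bergman_space_def L2_cmult holomorphic2_on_cmult)

text \<open>The mean value property is applied to \<open>h\<^sup>2\<close>, so that the integral of \<open>\<bar>h\<bar>\<^sup>2\<close> appears directly;
  on a compact ball the weight is bounded below by a positive constant \<open>m\<close>.\<close>

lemma bergman_point_evaluation:
  assumes z0: "z0 \<in> \<Omega>"
  obtains r K where "r > 0" "K > 0" "ball z0 r \<subseteq> \<Omega>"
    "\<And>h z. h \<in> bergman_space \<Omega> \<mu> \<Longrightarrow> z \<in> ball z0 r \<Longrightarrow> (cmod (h z))\<^sup>2 \<le> K * sqnorm h"
proof -
  obtain R where R: "R > 0" "cball z0 R \<subseteq> \<Omega>"
    using open_domain z0 open_contains_cball by blast
  define r where "r = R / 2"
  have r: "r > 0" using R by (simp add: r_def)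
  have "continuous_on (cball z0 R) \<mu>" using continuous_weight R by (blast intro: continuous_on_subset)
  moreover have "cball z0 R \<noteq> {}" using R by simp
  ultimately obtain x where x: "x \<in> cball z0 R" "\<And>y. y \<in> cball z0 R \<Longrightarrow> \<mu> x \<le> \<mu> y"
    using continuous_attains_inf[OF compact_cball] by blast
  define m where "m = \<mu> x"
  have m: "m > 0" using x(1) R weight_pos[of x] by (simp only: m_def) blast
  define V where "V = measure lborel (ball z0 r)"
  have V: "V > 0" using r by (simp add: V_def)
  have "(cmod (h z))\<^sup>2 \<le> 1 / (m * V) * sqnorm h"
    if h: "h \<in> bergman_space \<Omega> \<mu>" and z: "z \<in> ball z0 r" for h z
  proof -
    have sub: "ball z r \<subseteq> cball z0 R"
    proof
      fix y assume "y \<in> ball z r"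
      with z show "y \<in> cball z0 R" using dist_triangle[of z0 y z] by (simp add: r_def)
    qed
    have conth: "continuous_on \<Omega> h"
      using holomorphic2_on_imp_continuous_on[OF bergman_holomorphic[OF h]] .
    have conth2: "continuous_on \<Omega> (\<lambda>z. (cmod (h z))\<^sup>2)" by (intro continuous_intros conth)
    let ?E = "\<lambda>z. indicator \<Omega> z *\<^sub>R (\<mu> z *\<^sub>R (cmod (h z))\<^sup>2)"
    have E: "integrable lborel ?E" "sqnorm h = (\<integral>z. ?E z \<partial>lborel)"
      using L2_integrable[OF bergman_L2[OF h]] integrable_W_iff[OF conth2] integral_W[OF conth2]
      by (simp_all add: sqnorm_def)
    let ?B = "\<lambda>x. indicator (ball z r) x *\<^sub>R (h x * h x)"
    have le: "norm (?B x) \<le> 1 / m * ?E x" for x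
    proof (cases "x \<in> ball z r")
      case True
      then have "x \<in> cball z0 R" using sub by blast
      with x(2) have "m \<le> \<mu> x" "x \<in> \<Omega>" using R by (auto simp: m_def)
      then have "m * (cmod (h x))\<^sup>2 \<le> \<mu> x * (cmod (h x))\<^sup>2" by (intro mult_right_mono) auto
      then show ?thesis using True \<open>x \<in> \<Omega>\<close> m by (simp add: norm_mult power2_eq_square field_simps)
    next
      case False
      then show ?thesis using weight_pos m by (cases "x \<in> \<Omega>") (auto simp: less_imp_le)
    qed
    have meas: "?B \<in> borel_measurable borel"
      using sub R by (intro borel_measurable_continuous_on_indicator continuous_intros
          continuous_on_subset[OF conth]) auto
    have int: "integrable lborel ?B"
    proof (rule Bochner_Integration.integrable_bound[where f="\<lambda>x. 1 / m * ?E x"])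
      show "integrable lborel (\<lambda>x. 1 / m * ?E x)" using E(1) by (rule integrable_mult_right)
      show "AE x in lborel. norm (?B x) \<le> norm (1 / m * ?E x)"
        by (intro AE_I2 order_trans[OF le]) (simp only: real_norm_def abs_ge_self)
    qed (use meas in simp)
    have "measure lborel (ball z r) *\<^sub>R (h z * h z) = (\<integral>x. ?B x \<partial>lborel)"
      using holomorphic2_ball_mean[OF holomorphic2_on_mult[OF bergman_holomorphic[OF h] bergman_holomorphic[OF h]]
          open_domain, of z r] sub R int by (simp add: set_integrable_def subset_trans)
    moreover have "measure lborel (ball z r) = V" using r by (simp add: V_def content_ball)
    ultimately have "V * (cmod (h z))\<^sup>2 = norm (\<integral>x. ?B x \<partial>lborel)"
      using V by (simp add: norm_mult power2_eq_square flip: \<open>_ = (\<integral>x. ?B x \<partial>lborel)\<close>)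
    also have "\<dots> \<le> (\<integral>x. 1 / m * ?E x \<partial>lborel)"
      using integrable_norm[OF int] integrable_mult_right[OF E(1)] le
      by (intro order_trans[OF integral_norm_bound integral_mono])
    also have "\<dots> = sqnorm h / m" unfolding E(2) by (subst integral_mult_right_zero) simp
    finally show ?thesis using m V by (simp add: field_simps)
  qed
  moreover have "ball z0 r \<subseteq> \<Omega>" using R by (auto simp: r_def)
  ultimately show ?thesis using that[of r "1 / (m * V)"] r m V by auto
qed

lemma bergman_sqnorm_zero:
  assumes "h \<in> bergman_space \<Omega> \<mu>" "sqnorm h = 0" "z \<in> \<Omega>"
  shows "h z = 0"
proof -
  obtain r K where r: "r > 0" "\<And>x. x \<in> ball z r \<Longrightarrow> (cmod (h x))\<^sup>2 \<le> K * sqnorm h"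
    using bergman_point_evaluation[OF assms(3)] assms(1) by metis
  then show ?thesis using assms(2) r(2)[of z] by simp
qed

lemma bergman_projection_unique:
  assumes f: "f \<in> Lp_space 2 \<Omega> \<mu>"
    and g: "g \<in> bergman_space \<Omega> \<mu>" "\<And>h. h \<in> bergman_space \<Omega> \<mu> \<Longrightarrow> L2_inner \<Omega> \<mu> (\<lambda>z. f z - g z) h = 0"
    and g': "g' \<in> bergman_space \<Omega> \<mu>" "\<And>h. h \<in> bergman_space \<Omega> \<mu> \<Longrightarrow> L2_inner \<Omega> \<mu> (\<lambda>z. f z - g' z) h = 0"
    and z: "z \<in> \<Omega>"
  shows "g z = g' z"
proof -
  let ?u = "\<lambda>z. g z - g' z"
  have u: "?u \<in> bergman_space \<Omega> \<mu>" using g g' by (intro bergman_diff)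
  have "L2_inner \<Omega> \<mu> (\<lambda>z. (f z - g' z) - (f z - g z)) ?u = 0"
    using f g g' u by (subst L2_inner_diff_left) (auto intro: L2_diff bergman_L2)
  then have "sqnorm ?u = 0" by (simp add: L2_inner_self)
  then show ?thesis using bergman_sqnorm_zero[OF u _ z] by simp
qed

lemma bergman_projection_eqI:
  assumes f: "f \<in> Lp_space 2 \<Omega> \<mu>" and g: "g \<in> bergman_space \<Omega> \<mu>" "\<And>z. z \<notin> \<Omega> \<Longrightarrow> g z = 0"
    "\<And>h. h \<in> bergman_space \<Omega> \<mu> \<Longrightarrow> L2_inner \<Omega> \<mu> (\<lambda>z. f z - g z) h = 0"
  shows "bergman_projection \<Omega> \<mu> f = g"
  unfolding bergman_projection_def
proof (rule the_equality)
  fix g' assume g': "g' \<in> bergman_space \<Omega> \<mu> \<and> (\<forall>z. z \<notin> \<Omega> \<longrightarrow> g' z = 0) \<and>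
    (\<forall>h\<in>bergman_space \<Omega> \<mu>. L2_inner \<Omega> \<mu> (\<lambda>z. f z - g' z) h = 0)"
  show "g' = g"
  proof
    fix z show "g' z = g z"
    proof (cases "z \<in> \<Omega>")
      case True
      then show ?thesis using bergman_projection_unique[OF f, of g' g z] g g' by blast
    next
      case False
      have "g' z = 0" using g' False by blast
      moreover have "g z = 0" using g(2) False by blast
      ultimately show ?thesis by simp
    qed
  qed
qed (use g in auto)

text \<open>If the inner product \<open>s\<close> of \<open>u\<close> and \<open>h\<close> were nonzero, then subtracting \<open>t s h\<close> from \<open>u\<close> for a
  small \<open>t > 0\<close> would decrease the norm.\<close>

lemma minimizer_orthogonal:
  assumes u: "u \<in> Lp_space 2 \<Omega> \<mu>" and h: "h \<in> Lp_space 2 \<Omega> \<mu>"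
    and min: "\<And>c. sqnorm u \<le> sqnorm (\<lambda>z. u z - c * h z)"
  shows "L2_inner \<Omega> \<mu> u h = 0"
proof -
  let ?s = "L2_inner \<Omega> \<mu> u h"
  \<comment> \<open>Small enough for \<open>t * sqnorm h < 2\<close>; the summand \<open>1\<close> covers the case \<open>sqnorm h = 0\<close>.\<close>
  define t where "t = 1 / (sqnorm h + 1)"
  have pos: "sqnorm h + 1 > 0" by (simp add: add_nonneg_pos)
  then have t: "t > 0" by (simp add: t_def)
  have tE: "t * sqnorm h \<le> 1" using pos by (simp add: t_def)
  have "0 \<le> - 2 * Re (cnj (of_real t * ?s) * ?s) + (cmod (of_real t * ?s))\<^sup>2 * sqnorm h"
    using min[of "of_real t * ?s"] sqnorm_minus_multiple[OF u h, of "of_real t * ?s"] by simp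
  also have "cnj (of_real t * ?s) * ?s = of_real (t * (cmod ?s)\<^sup>2)"
    by (simp only: of_real_mult complex_norm_square complex_cnj_mult complex_cnj_complex_of_real mult_ac)
  also have "- 2 * Re (of_real (t * (cmod ?s)\<^sup>2)) + (cmod (of_real t * ?s))\<^sup>2 * sqnorm h =
      t * (cmod ?s)\<^sup>2 * (t * sqnorm h - 2)"
    by (simp add: norm_mult power2_eq_square algebra_simps)
  finally have "0 \<le> t * (cmod ?s)\<^sup>2 * (t * sqnorm h - 2)" .
  then show ?thesis using t tE by (auto simp: zero_le_mult_iff mult_le_0_iff)
qed

text \<open>By the parallelogram law a sequence \<open>h\<close> in the Bergman space that minimizes the distance to \<open>f\<close>
  is a Cauchy sequence in norm, hence locally uniformly by \<open>bergman_point_evaluation\<close>. Its limit is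
  holomorphic, and by Fatou's lemma its distance to \<open>f\<close> is at most the infimum \<open>d\<close>.\<close>

lemma bergman_projection_exists:
  assumes f: "f \<in> Lp_space 2 \<Omega> \<mu>"
  obtains g where "g \<in> bergman_space \<Omega> \<mu>" "\<And>z. z \<notin> \<Omega> \<Longrightarrow> g z = 0"
    "\<And>h. h \<in> bergman_space \<Omega> \<mu> \<Longrightarrow> L2_inner \<Omega> \<mu> (\<lambda>z. f z - g z) h = 0"
proof -
  let ?A = "bergman_space \<Omega> \<mu>"
  let ?D = "(\<lambda>h. sqnorm (\<lambda>z. f z - h z)) ` ?A"
  define d where "d = Inf ?D"
  have zero: "(\<lambda>z. 0) \<in> ?A"
    by (simp add: bergman_space_def L2_space_iff holomorphic2_on_const)
  have bdd: "bdd_below ?D" by (rule bdd_belowI[of _ 0]) auto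
  have lower: "d \<le> sqnorm (\<lambda>z. f z - h z)" if "h \<in> ?A" for h
    unfolding d_def using bdd that by (intro cInf_lower) auto
  have "\<exists>h\<in>?A. sqnorm (\<lambda>z. f z - h z) < d + 1 / Suc n" for n
  proof -
    have "Inf ?D < d + 1 / Suc n" by (simp add: d_def)
    then show ?thesis using zero cInf_lessD[of ?D] by blast
  qed
  then obtain h where h: "\<And>n. h n \<in> ?A" "\<And>n. sqnorm (\<lambda>z. f z - h n z) < d + 1 / Suc n"
    by metis
  have fh: "(\<lambda>z. f z - h n z) \<in> Lp_space 2 \<Omega> \<mu>" for n
    using f bergman_L2[OF h(1)] by (rule L2_diff)
  have cauchy: "sqnorm (\<lambda>z. h m z - h n z) \<le> 2 / Suc n + 2 / Suc m" for m n
  proof -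
    \<comment> \<open>The midpoint of \<open>h m\<close> and \<open>h n\<close> is in the Bergman space, so it is at squared distance at least \<open>d\<close>.\<close>
    have mid: "(\<lambda>z. 1 / 2 * (h n z + h m z)) \<in> ?A"
      using h by (intro bergman_cmult bergman_add)
    have "(\<lambda>z. (f z - h n z) + (f z - h m z)) = (\<lambda>z. 2 * (f z - 1 / 2 * (h n z + h m z)))"
      by (auto simp: algebra_simps)
    then have "sqnorm (\<lambda>z. (f z - h n z) + (f z - h m z)) = 4 * sqnorm (\<lambda>z. f z - 1 / 2 * (h n z + h m z))"
      by (simp only: sqnorm_cmult) simp
    with lower[OF mid] have "4 * d \<le> sqnorm (\<lambda>z. (f z - h n z) + (f z - h m z))" by simp
    with sqnorm_parallelogram[OF fh[of n] fh[of m]] h(2)[of n] h(2)[of m]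
    show ?thesis by simp
  qed
  have unif: "\<exists>r>0. ball z r \<subseteq> \<Omega> \<and> uniformly_Cauchy_on (ball z r) h" if z: "z \<in> \<Omega>" for z
  proof -
    obtain r K where r: "r > 0" "K > 0" "ball z r \<subseteq> \<Omega>"
      and K: "\<And>h x. h \<in> ?A \<Longrightarrow> x \<in> ball z r \<Longrightarrow> (cmod (h x))\<^sup>2 \<le> K * sqnorm h"
      using bergman_point_evaluation[OF z] by metis
    have "uniformly_Cauchy_on (ball z r) h"
      unfolding uniformly_Cauchy_on_def
    proof (intro allI impI)
      fix e :: real assume e: "e > 0"
      \<comment> \<open>From \<open>N\<close> on, \<open>K * (2 / Suc n + 2 / Suc m) < e\<^sup>2\<close>.\<close>
      define N where "N = nat \<lceil>4 * K / e\<^sup>2\<rceil>"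
      have N: "4 * K / e\<^sup>2 < Suc N" unfolding N_def by linarith
      show "\<exists>M. \<forall>x\<in>ball z r. \<forall>m\<ge>M. \<forall>n\<ge>M. dist (h m x) (h n x) < e"
      proof (intro exI[of _ N] ballI allI impI)
        fix x m n assume x: "x \<in> ball z r" and mn: "N \<le> m" "N \<le> n"
        have inv: "2 / real (Suc k) \<le> 2 / Suc N" if "N \<le> k" for k
          using that by (intro divide_left_mono) auto
        have "(cmod (h m x - h n x))\<^sup>2 \<le> K * sqnorm (\<lambda>z. h m z - h n z)"
          using K[OF bergman_diff[OF h(1)[of m] h(1)[of n]] x] .
        also have "\<dots> \<le> K * (4 / Suc N)"
          using cauchy[of m n] inv[OF mn(1)] inv[OF mn(2)] r(2) by (intro mult_left_mono) auto
        also have "\<dots> < e\<^sup>2" using N e by (simp add: field_simps)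
        finally show "dist (h m x) (h n x) < e"
          using e by (simp add: dist_norm power_less_imp_less_base)
      qed
    qed
    then show ?thesis using r by blast
  qed
  define g where "g z = (if z \<in> \<Omega> then lim (\<lambda>n. h n z) else 0)" for z
  have hg: "(\<lambda>n. h n z) \<longlonglongrightarrow> g z" if "z \<in> \<Omega>" for z
    using holomorphic2_on_locally_uniform_limit(2)[OF open_domain bergman_holomorphic[OF h(1)] unif that]
      that by (simp add: g_def)
  have g_hol: "g holomorphic2_on \<Omega>"
  proof -
    have "(\<lambda>z. lim (\<lambda>n. h n z)) holomorphic2_on \<Omega>"
      by (rule holomorphic2_on_locally_uniform_limit(1)[OF open_domain bergman_holomorphic[OF h(1)] unif])
    moreover have "(g has_derivative D) (at z within \<Omega>)"
      if "((\<lambda>z. lim (\<lambda>n. h n z)) has_derivative D) (at z within \<Omega>)" "z \<in> \<Omega>" for D z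
      by (rule has_derivative_transform[OF that(2) _ that(1)]) (simp add: g_def)
    ultimately show ?thesis unfolding holomorphic2_on_def by blast
  qed
  have gm: "g \<in> borel_measurable W"
    by (intro continuous_imp_measurable_W holomorphic2_on_imp_continuous_on g_hol)
  have "(\<integral>\<^sup>+z. ennreal ((cmod (f z - g z))\<^sup>2) \<partial>W) =
      (\<integral>\<^sup>+z. liminf (\<lambda>n. ennreal ((cmod (f z - h n z))\<^sup>2)) \<partial>W)"
  proof (rule nn_integral_cong)
    fix z assume "z \<in> space W"
    then have "(\<lambda>n. ennreal ((cmod (f z - h n z))\<^sup>2)) \<longlonglongrightarrow> ennreal ((cmod (f z - g z))\<^sup>2)"
      using hg by (intro tendsto_intros) auto
    then show "ennreal ((cmod (f z - g z))\<^sup>2) = liminf (\<lambda>n. ennreal ((cmod (f z - h n z))\<^sup>2))"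
      by (intro lim_imp_Liminf[symmetric]) auto
  qed
  also have "\<dots> \<le> liminf (\<lambda>n. \<integral>\<^sup>+z. ennreal ((cmod (f z - h n z))\<^sup>2) \<partial>W)"
  proof (rule nn_integral_liminf)
    fix n
    have [measurable]: "(\<lambda>z. f z - h n z) \<in> borel_measurable W" by (rule L2_measurable[OF fh])
    show "(\<lambda>z. ennreal ((cmod (f z - h n z))\<^sup>2)) \<in> borel_measurable W" by measurable
  qed
  also have "\<dots> = liminf (\<lambda>n. ennreal (sqnorm (\<lambda>z. f z - h n z)))"
    using L2_integrable[OF fh] by (simp add: sqnorm_def nn_integral_eq_integral)
  also have "\<dots> \<le> liminf (\<lambda>n. ennreal (d + 1 / Suc n))"
    using h(2) by (intro Liminf_mono always_eventually allI ennreal_leI) (auto intro: less_imp_le)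
  also have "\<dots> = ennreal d"
  proof (rule lim_imp_Liminf)
    have "(\<lambda>n. d + 1 / Suc n) \<longlonglongrightarrow> d + 0"
      by (intro tendsto_intros LIMSEQ_Suc lim_1_over_n)
    then show "(\<lambda>n. ennreal (d + 1 / Suc n)) \<longlonglongrightarrow> ennreal d"
      by (intro tendsto_ennrealI) simp
  qed simp
  finally have le: "(\<integral>\<^sup>+z. ennreal ((cmod (f z - g z))\<^sup>2) \<partial>W) \<le> ennreal d" .
  have fg: "(\<lambda>z. f z - g z) \<in> Lp_space 2 \<Omega> \<mu>"
    unfolding L2_space_iff integrable_iff_bounded
    using L2_measurable[OF f] gm le by (auto simp: le_less_trans)
  have "(\<lambda>z. f z - (f z - g z)) \<in> Lp_space 2 \<Omega> \<mu>" using f fg by (rule L2_diff)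
  then have g: "g \<in> ?A" using g_hol by (simp add: bergman_space_def)
  have "0 \<le> d" unfolding d_def using zero by (intro cInf_greatest) auto
  moreover have "ennreal (sqnorm (\<lambda>z. f z - g z)) \<le> ennreal d"
    using le L2_integrable[OF fg] by (simp add: sqnorm_def nn_integral_eq_integral)
  ultimately have gd: "sqnorm (\<lambda>z. f z - g z) \<le> d" by simp
  have "L2_inner \<Omega> \<mu> (\<lambda>z. f z - g z) k = 0" if k: "k \<in> ?A" for k
  proof (rule minimizer_orthogonal[OF fg bergman_L2[OF k]])
    fix c
    have "(\<lambda>z. g z + c * k z) \<in> ?A" using g k by (intro bergman_add bergman_cmult)
    from lower[OF this] gd show "sqnorm (\<lambda>z. f z - g z) \<le> sqnorm (\<lambda>z. f z - g z - c * k z)"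
      by (simp add: algebra_simps)
  qed
  then show ?thesis using that[of g] g by (simp add: g_def)
qed

text \<open>Pythagoras: \<open>f - g\<close> and its projection \<open>g\<close> are orthogonal, so the squared norm of \<open>f\<close> is the sum
  of theirs.\<close>

theorem bergman_projection_bounded_2: "bergman_projection_bounded 2 \<Omega> \<mu>"
  unfolding bergman_projection_bounded_def
proof (intro exI[of _ 1] conjI ballI)
  fix f assume "f \<in> Lp_space 2 \<Omega> \<mu> \<inter> Lp_space 2 \<Omega> \<mu>"
  then have f: "f \<in> Lp_space 2 \<Omega> \<mu>" by simp
  obtain g where g: "g \<in> bergman_space \<Omega> \<mu>" "\<And>z. z \<notin> \<Omega> \<Longrightarrow> g z = 0"
    "\<And>h. h \<in> bergman_space \<Omega> \<mu> \<Longrightarrow> L2_inner \<Omega> \<mu> (\<lambda>z. f z - g z) h = 0"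
    using bergman_projection_exists[OF f] by blast
  have P: "bergman_projection \<Omega> \<mu> f = g" using f g by (rule bergman_projection_eqI)
  show "bergman_projection \<Omega> \<mu> f \<in> Lp_space 2 \<Omega> \<mu>" using g P bergman_L2 by simp
  have "sqnorm (\<lambda>z. (f z - g z) - (- 1) * g z) = sqnorm (\<lambda>z. f z - g z) + sqnorm g"
    by (subst sqnorm_minus_multiple) (use g f in \<open>auto intro: L2_diff bergman_L2\<close>)
  then have "sqnorm g \<le> sqnorm f" by simp
  then show "Lp_norm 2 \<Omega> \<mu> (bergman_projection \<Omega> \<mu> f) \<le> 1 * Lp_norm 2 \<Omega> \<mu> f"
    unfolding Lp_norm_def P by (simp add: sqnorm_def powr_mono2)
qed simp

end

section \<open>Radial averages on the Hartogs triangle\<close>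

lemma hartogs_iff: "z \<in> hartogs_triangle \<longleftrightarrow> cmod (snd z) < cmod (fst z) \<and> cmod (fst z) < 1"
  by (auto simp: hartogs_triangle_def)

lemma hartogs_fst: "z \<in> hartogs_triangle \<Longrightarrow> 0 < cmod (fst z) \<and> cmod (fst z) < 1"
  unfolding hartogs_iff using norm_ge_zero[of "snd z"] by linarith

lemma hartogs_open: "open hartogs_triangle"
proof -
  have eq: "hartogs_triangle = {z. cmod (snd z) < cmod (fst z)} \<inter> {z. cmod (fst z) < 1}"
    by (auto simp: hartogs_triangle_def)
  show ?thesis unfolding eq by (intro open_Int open_Collect_less continuous_intros)
qed

interpretation hartogs: weighted_domain hartogs_triangle hartogs_weight
proof
  show "continuous_on hartogs_triangle hartogs_weight"
    unfolding hartogs_weight_def using hartogs_fst by (intro continuous_intros) force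
qed (auto simp: hartogs_open hartogs_weight_def)

abbreviation hartogs_measure :: "(complex \<times> complex) measure" where
  "hartogs_measure \<equiv> weighted_measure hartogs_triangle hartogs_weight"

lemma continuous_on_radial:
  fixes P :: "real \<Rightarrow> 'b::topological_space"
  assumes "continuous_on {0<..<1} P"
  shows "continuous_on hartogs_triangle (\<lambda>z. P (cmod (fst z)))"
  by (rule continuous_on_compose2[OF assms]) (auto intro!: continuous_intros dest: hartogs_fst)

lemma continuous_on_powr_radial: "continuous_on hartogs_triangle (\<lambda>z. cmod (fst z) powr s)"
  by (rule continuous_on_radial[where P = "\<lambda>r. r powr s"]) (auto intro!: continuous_intros)

text \<open>The factor \<open>P (cmod (fst z))\<close>, the weight and the triangle are invariant under rotations of either
  coordinate, so \<open>F\<close> may be replaced by its averages. Rotating \<open>z\<^sub>2\<close> replaces \<open>F (z\<^sub>1, z\<^sub>2)\<close> by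
  \<open>F (z\<^sub>1, 0)\<close>; rotating \<open>z\<^sub>1\<close> then leaves the constant Laurent coefficient of \<open>F (\<cdot>, 0)\<close>, which
  is \<open>c\<close>.\<close>

lemma hartogs_radial_mean:
  assumes F: "F holomorphic2_on hartogs_triangle" and P: "continuous_on {0<..<1} P"
    and intP: "integrable hartogs_measure (\<lambda>z. P (cmod (fst z)))"
    and intF: "integrable hartogs_measure (\<lambda>z. P (cmod (fst z)) *\<^sub>R F z)"
  obtains c where "(\<integral>z. P (cmod (fst z)) *\<^sub>R F z \<partial>hartogs_measure) =
      (\<integral>z. P (cmod (fst z)) \<partial>hartogs_measure) *\<^sub>R c"
proof -
  let ?H = hartogs_triangle
  have contF: "continuous_on ?H F" by (rule holomorphic2_on_imp_continuous_on[OF F])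
  have axis: "(fst z, 0) \<in> ?H" if "z \<in> ?H" for z
    using that hartogs_fst[OF that] by (simp add: hartogs_iff)
  have contF0: "continuous_on ?H (\<lambda>z. F (fst z, 0))"
    by (intro continuous_on_compose2[OF contF] continuous_intros) (auto intro: axis)
  have contPF: "continuous_on ?H (\<lambda>z. P (cmod (fst z)) *\<^sub>R F z)"
    and contPF0: "continuous_on ?H (\<lambda>z. P (cmod (fst z)) *\<^sub>R F (fst z, 0))"
    by (intro continuous_intros continuous_on_radial[OF P] contF contF0)+
  define Q where "Q z = indicator ?H z * (hartogs_weight z * P (cmod (fst z)))" for z
  define T1 where "T1 t z = (fst z, snd z * turn t)" for t and z :: "complex \<times> complex"
  define T2 where "T2 t z = (fst z * turn t, snd z)" for t and z :: "complex \<times> complex"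
  have inv: "T1 t z \<in> ?H \<longleftrightarrow> z \<in> ?H" "T2 t z \<in> ?H \<longleftrightarrow> z \<in> ?H"
    "Q (T1 t z) = Q z" "Q (T2 t z) = Q z" for t z
    by (simp_all add: T1_def T2_def Q_def hartogs_iff hartogs_weight_def norm_mult indicator_def)
  have lin: "linear (T1 t)" "linear (T2 t)" for t
    by (auto intro!: linearI simp: T1_def T2_def algebra_simps)
  have iso: "norm (T1 t z) = norm z" "norm (T2 t z) = norm z" for t z
    by (simp_all add: T1_def T2_def norm_prod_def norm_mult)
  have cont: "continuous_on UNIV (\<lambda>(t, z). T1 t z)" "continuous_on UNIV (\<lambda>(t, z). T2 t z)"
    unfolding T1_def T2_def split_beta by (intro continuous_intros)+
  have meas: "(\<lambda>(t, z). T1 t z) \<in> borel_measurable (borel \<Otimes>\<^sub>M borel)"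
    "(\<lambda>(t, z). T2 t z) \<in> borel_measurable (borel \<Otimes>\<^sub>M borel)"
    unfolding borel_prod by (intro borel_measurable_continuous_onI cont)+
  have contt: "continuous_on {0..1} (\<lambda>t. T1 t z)" "continuous_on {0..1} (\<lambda>t. T2 t z)" for z
    unfolding T1_def T2_def by (intro continuous_intros)+
  define G where "G z = Q z *\<^sub>R F z" for z
  define G1 where "G1 z = Q z *\<^sub>R F (fst z, 0)" for z
  \<comment> \<open>The base point \<open>1 / 2\<close> is an arbitrary point of the punctured disc.\<close>
  define c where "c = integral {0..1} (\<lambda>t. F (1 / 2 * turn t, 0))"
  have G_eq: "G = (\<lambda>z. indicator ?H z *\<^sub>R (hartogs_weight z *\<^sub>R (P (cmod (fst z)) *\<^sub>R F z)))"
    and G1_eq: "G1 = (\<lambda>z. indicator ?H z *\<^sub>R (hartogs_weight z *\<^sub>R (P (cmod (fst z)) *\<^sub>R F (fst z, 0))))"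
    by (simp_all add: G_def G1_def Q_def fun_eq_iff)
  have Gi: "integrable lborel G"
    using intF unfolding hartogs.integrable_W_iff[OF contPF] G_eq .
  have Gm: "G \<in> borel_measurable borel" "G1 \<in> borel_measurable borel"
    unfolding G_eq G1_eq by (intro hartogs.measurable_extend contPF contPF0)+
  have contG: "continuous_on {0..1} (\<lambda>t. G (T1 t z))" for z
  proof (cases "z \<in> ?H")
    case True
    then show ?thesis unfolding G_def inv
      by (intro continuous_intros continuous_on_compose2[OF contF contt(1)]) (auto simp: inv)
  qed (simp add: G_def inv, simp add: Q_def)
  have contG1: "continuous_on {0..1} (\<lambda>t. G1 (T2 t z))" for z
  proof (cases "z \<in> ?H")
    case True
    then show ?thesis unfolding G1_def inv
      by (intro continuous_intros continuous_on_compose2[OF contF0 contt(2)]) (auto simp: inv)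
  qed (simp add: G1_def inv, simp add: Q_def)
  have avg1: "integral {0..1} (\<lambda>t. G (T1 t z)) = G1 z" for z
  proof (cases "z \<in> ?H")
    case True
    have "integral {0..1} (\<lambda>t. F (fst z, snd z * turn t)) = integral {0..1} (\<lambda>t. F (fst z, 0 * turn t))"
    proof (rule rotation_mean_constant[where S = "ball 0 (cmod (fst z))"])
      have "(\<lambda>u. F ((fst z, 0) + cscale u (0, 1))) holomorphic_on ball 0 (cmod (fst z))"
        using True by (intro holomorphic2_on_line[OF F hartogs_open]) (auto simp: hartogs_iff)
      then show "(\<lambda>u. F (fst z, u)) holomorphic_on ball 0 (cmod (fst z))"
        by (simp add: cscale_def)
    qed (use True in \<open>auto simp: norm_mult hartogs_iff\<close>)
    then show ?thesis unfolding G_def inv by (simp add: T1_def G1_def)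
  qed (simp add: G_def G1_def inv, simp add: Q_def)
  have avg2: "integral {0..1} (\<lambda>t. G1 (T2 t z)) = Q z *\<^sub>R c" for z
  proof (cases "z \<in> ?H")
    case True
    have "integral {0..1} (\<lambda>t. F (fst z * turn t, 0)) = integral {0..1} (\<lambda>t. F (1 / 2 * turn t, 0))"
    proof (rule rotation_mean_constant[where S = "ball 0 1 - {0}"])
      have "(\<lambda>u. F (0 + cscale u (1, 0))) holomorphic_on ball 0 1 - {0}"
        by (intro holomorphic2_on_line[OF F hartogs_open]) (auto simp: hartogs_iff)
      then show "(\<lambda>u. F (u, 0)) holomorphic_on ball 0 1 - {0}" by (simp add: cscale_def)
      show "connected (ball (0::complex) 1 - {0})" by (rule connected_punctured_ball) simp
    qed (use hartogs_fst[OF True] in \<open>auto simp: norm_mult\<close>)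
    then show ?thesis unfolding G1_def inv by (simp add: T2_def c_def)
  qed (simp add: G1_def inv, simp add: Q_def)
  note A1 = integral_lborel_average[OF Gi Gm(1) meas(1) lin(1) iso(1) contG, unfolded avg1]
  note A2 = integral_lborel_average[OF A1(1) Gm(2) meas(2) lin(2) iso(2) contG1, unfolded avg2]
  have "(\<integral>z. P (cmod (fst z)) *\<^sub>R F z \<partial>hartogs_measure) = (\<integral>z. G z \<partial>lborel)"
    unfolding hartogs.integral_W[OF contPF] G_eq ..
  also have "\<dots> = (\<integral>z. Q z *\<^sub>R c \<partial>lborel)" using A1(2) A2(2) by simp
  also have "\<dots> = (\<integral>z. Q z \<partial>lborel) *\<^sub>R c"
    using intP unfolding hartogs.integrable_W_iff[OF continuous_on_radial[OF P]]
    by (intro integral_scaleR_left) (simp add: Q_def)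
  also have "(\<integral>z. Q z \<partial>lborel) = (\<integral>z. P (cmod (fst z)) \<partial>hartogs_measure)"
    unfolding hartogs.integral_W[OF continuous_on_radial[OF P]] by (simp add: Q_def)
  finally show ?thesis by (rule that)
qed

section \<open>Moments of the weight\<close>

definition moment :: "real \<Rightarrow> real"
  where "moment s = (\<integral>z. cmod (fst z) powr (- s) \<partial>hartogs_measure)"

text \<open>With \<open>t = 1 / r\<close>, the function \<open>t\<^sup>s e\<^sup>-\<^sup>t\<close> is largest at \<open>t = s\<close>.\<close>

lemma powr_exp_bound:
  fixes r s :: real
  assumes "0 < r" "0 < s"
  shows "exp (- (1 / r)) * r powr (- s) \<le> s powr s * exp (- s)"
proof -
  have "ln (1 / (r * s)) \<le> 1 / (r * s) - 1" using assms by (intro ln_le_minus_one) simp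
  then have "s * (- ln r - ln s) \<le> s * (1 / (r * s) - 1)"
    using assms by (intro mult_left_mono) (simp_all add: ln_div ln_mult)
  then have "- (1 / r) + - s * ln r \<le> s * ln s + - s" using assms by (simp add: algebra_simps)
  then show ?thesis using assms by (simp add: powr_def flip: exp_add)
qed

lemma hartogs_finite_measure: "emeasure lborel hartogs_triangle < \<infinity>"
proof -
  have "hartogs_triangle \<subseteq> ball 0 2"
  proof
    fix z assume "z \<in> hartogs_triangle"
    then have "norm (fst z) < 1" "norm (snd z) < 1" by (auto simp: hartogs_iff)
    then have "norm z < 2" using norm_fst_le norm_snd_le norm_Pair_le[of "fst z" "snd z"] by simp
    then show "z \<in> ball 0 2" by simp
  qed
  then have "emeasure lborel hartogs_triangle \<le> emeasure lborel (ball (0 :: complex \<times> complex) 2)"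
    by (intro emeasure_mono) auto
  also have "\<dots> < \<infinity>" by (rule emeasure_lborel_ball_finite)
  finally show ?thesis .
qed

lemma moment_lborel:
  shows "moment s = (\<integral>z. indicator hartogs_triangle z *\<^sub>R
      (hartogs_weight z *\<^sub>R cmod (fst z) powr (- s)) \<partial>lborel)"
  unfolding moment_def by (rule hartogs.integral_W[OF continuous_on_powr_radial])

lemma
  assumes s: "s > 0"
  shows moment_integrable: "integrable hartogs_measure (\<lambda>z. cmod (fst z) powr (- s))"
    and moment_upper: "moment s \<le> measure lborel hartogs_triangle * (s powr s * exp (- s))"
proof -
  let ?f = "\<lambda>z. indicator hartogs_triangle z *\<^sub>R (hartogs_weight z *\<^sub>R cmod (fst z) powr (- s))"
  let ?g = "\<lambda>z :: complex \<times> complex. indicator hartogs_triangle z * (s powr s * exp (- s))"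
  have le: "?f z \<le> ?g z" and nonneg: "0 \<le> ?f z" for z
    using powr_exp_bound[of "cmod (fst z)" s] s hartogs_fst[of z]
    by (cases "z \<in> hartogs_triangle"; simp add: hartogs_weight_def)+
  have g: "integrable lborel ?g"
    using hartogs_finite_measure by (intro integrable_mult_left integrable_real_indicator) auto
  have f: "integrable lborel ?f"
  proof (rule Bochner_Integration.integrable_bound[OF g])
    show "?f \<in> borel_measurable lborel"
      using hartogs.measurable_extend[OF continuous_on_powr_radial] by simp
    show "AE z in lborel. norm (?f z) \<le> norm (?g z)"
      using le nonneg by (intro AE_I2) (metis abs_of_nonneg order_trans real_norm_def)
  qed
  then show "integrable hartogs_measure (\<lambda>z. cmod (fst z) powr (- s))"
    unfolding hartogs.integrable_W_iff[OF continuous_on_powr_radial] .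
  have "moment s \<le> (\<integral>z. ?g z \<partial>lborel)"
    unfolding moment_lborel using f g le by (rule integral_mono)
  also have "\<dots> = measure lborel hartogs_triangle * (s powr s * exp (- s))" by simp
  finally show "moment s \<le> measure lborel hartogs_triangle * (s powr s * exp (- s))" .
qed

text \<open>For \<open>1 / \<bar>z\<^sub>1\<bar>\<close> between \<open>s\<close> and \<open>s + 1\<close> the integrand is within a factor \<open>e\<close> of its maximum
  \<open>s\<^sup>s e\<^sup>-\<^sup>s\<close>, and that part of the triangle contains a ball of radius comparable to \<open>s\<^sup>-\<^sup>2\<close>, hence of
  volume comparable to \<open>s\<^sup>-\<^sup>8\<close>.\<close>

lemma moment_lower:
  obtains \<kappa> where "\<kappa> > 0" "\<And>s. s \<ge> 1 \<Longrightarrow> \<kappa> * s powr (s - 8) * exp (- s) \<le> moment s"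
proof -
  define v where "v = measure lborel (ball (0 :: complex \<times> complex) 1)"
  have v: "v > 0" by (simp add: v_def)
  have "v * exp (- 1) / 256 * s powr (s - 8) * exp (- s) \<le> moment s" if s: "s \<ge> 1" for s
  proof -
    \<comment> \<open>Centre and radius of a ball whose points satisfy \<open>1 / (s + 1) < \<bar>z\<^sub>1\<bar> < 1 / s\<close>.\<close>
    define \<rho> where "\<rho> = 1 / (2 * s * (s + 1))"
    define m where "m = (1 / s + 1 / (s + 1)) / 2"
    have \<rho>: "\<rho> > 0" using s by (simp add: \<rho>_def)
    have "\<rho> = (1 / s - 1 / (s + 1)) / 2" using s by (simp add: \<rho>_def divide_simps)
    then have mr: "m - \<rho> = 1 / (s + 1)" "m + \<rho> = 1 / s"
      by (simp_all add: m_def field_simps)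
    have m0: "m > 0" using s by (simp add: m_def add_pos_pos)
    let ?B = "ball (of_real m :: complex, 0 :: complex) \<rho>"
    have B: "1 / (s + 1) < cmod (fst z)" "cmod (fst z) < 1 / s" "cmod (snd z) < \<rho>" if "z \<in> ?B" for z
    proof -
      have "(of_real m, 0) - z = (of_real m - fst z, - snd z)" by (simp add: prod_eq_iff)
      then have *: "norm (of_real m - fst z, - snd z) < \<rho>" using that by (simp add: dist_norm)
      have 1: "cmod (of_real m - fst z) < \<rho>" by (rule le_less_trans[OF norm_fst_le *])
      show "cmod (snd z) < \<rho>" using le_less_trans[OF norm_snd_le *] by simp
      have "\<bar>m - cmod (fst z)\<bar> \<le> cmod (of_real m - fst z)"
        using norm_triangle_ineq3[of "of_real m" "fst z"] m0 by simp
      with 1 mr show "1 / (s + 1) < cmod (fst z)" "cmod (fst z) < 1 / s" by linarith+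
    qed
    have sub: "?B \<subseteq> hartogs_triangle"
    proof
      fix z assume z: "z \<in> ?B"
      have "\<rho> \<le> 1 / (s + 1)"
        unfolding \<rho>_def using s mult_right_mono[of 1 "2 * s" "s + 1"] by (intro divide_left_mono) auto
      moreover have "1 / s \<le> 1" using s by simp
      ultimately show "z \<in> hartogs_triangle" using B[OF z] by (simp add: hartogs_iff)
    qed
    let ?f = "\<lambda>z. indicator hartogs_triangle z *\<^sub>R (hartogs_weight z *\<^sub>R cmod (fst z) powr (- s))"
    let ?L = "exp (- (s + 1)) * s powr s"
    have le: "indicator ?B z * ?L \<le> ?f z" for z
    proof (cases "z \<in> ?B")
      case True
      have z0: "cmod (fst z) > 0" using B(1)[OF True] s by (smt (verit) divide_pos_pos)
      have "exp (- (s + 1)) \<le> hartogs_weight z"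
        using B(1)[OF True] s z0 by (simp add: hartogs_weight_def field_simps)
      moreover have "(1 / s) powr (- s) \<le> cmod (fst z) powr (- s)"
        using B(2)[OF True] s z0 by (intro powr_mono2') auto
      then have "s powr s \<le> cmod (fst z) powr (- s)" using s by (simp add: powr_minus powr_divide)
      ultimately have "?L \<le> hartogs_weight z * cmod (fst z) powr (- s)"
        by (intro mult_mono) (auto simp: hartogs_weight_def)
      moreover have "z \<in> hartogs_triangle" using True sub by blast
      ultimately show ?thesis using True by simp
    qed (simp add: hartogs_weight_def)
    have vol: "measure lborel ?B = v * \<rho> ^ 4"
      using content_ball_conv_unit_ball[of \<rho> "(of_real m, 0) :: complex \<times> complex"] \<rho> by (simp add: v_def)
    have "v * \<rho> ^ 4 * ?L = (\<integral>z. indicator ?B z * ?L \<partial>lborel)" by (simp flip: vol)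
    also have "\<dots> \<le> (\<integral>z. ?f z \<partial>lborel)"
    proof (rule integral_mono[OF _ _ le])
      show "integrable lborel (\<lambda>z. indicator ?B z * ?L)"
        by (intro integrable_mult_left integrable_real_indicator emeasure_lborel_ball_finite) auto
      show "integrable lborel ?f"
        using moment_integrable[of s] s hartogs.integrable_W_iff[OF continuous_on_powr_radial] by simp
    qed
    also have "\<dots> = moment s" by (rule moment_lborel[symmetric])
    finally have lower: "v * \<rho> ^ 4 * ?L \<le> moment s" .
    have "1 / (4 * s ^ 2) \<le> \<rho>"
      unfolding \<rho>_def power2_eq_square using s mult_left_mono[of "s + 1" "2 * s" "2 * s"]
      by (intro divide_left_mono) auto
    then have "(1 / (4 * s ^ 2)) ^ 4 \<le> \<rho> ^ 4" using s by (intro power_mono) auto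
    then have "v * (1 / (4 * s ^ 2)) ^ 4 * ?L \<le> v * \<rho> ^ 4 * ?L"
      using v by (intro mult_right_mono mult_left_mono) auto
    moreover have "v * (1 / (4 * s ^ 2)) ^ 4 * ?L = v * exp (- 1) / 256 * s powr (s - 8) * exp (- s)"
    proof -
      have "s powr (s - 8) = s powr s / s ^ 8" using s by (simp add: powr_diff powr_realpow)
      moreover have "exp (- (s + 1)) = exp (- 1) * exp (- s)" by (simp flip: exp_add)
      ultimately show ?thesis using s by (simp add: power_divide power_mult_distrib flip: power_mult)
    qed
    ultimately show ?thesis using lower by linarith
  qed
  then show ?thesis using that[of "v * exp (- 1) / 256"] v by simp
qed

lemma moment_pos: "s \<ge> 1 \<Longrightarrow> moment s > 0"
  by (metis less_le_trans moment_lower mult_pos_pos exp_gt_zero powr_gt_zero not_one_le_zero)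

section \<open>Projections of radial multiples of a monomial\<close>

lemma fst_power_holomorphic:
  "(\<lambda>z. fst z ^ n) holomorphic2_on hartogs_triangle"
  "(\<lambda>z. inverse (fst z) ^ n) holomorphic2_on hartogs_triangle"
proof -
  have h: "(\<lambda>u :: complex. u ^ n) holomorphic_on - {0}" "(\<lambda>u :: complex. inverse u ^ n) holomorphic_on - {0}"
    by (intro holomorphic_intros; simp)+
  have "fst z \<in> - {0}" if "z \<in> hartogs_triangle" for z using hartogs_fst[OF that] by auto
  then show "(\<lambda>z. fst z ^ n) holomorphic2_on hartogs_triangle"
    "(\<lambda>z. inverse (fst z) ^ n) holomorphic2_on hartogs_triangle"
    using holomorphic2_on_compose_fst[OF h(1)] holomorphic2_on_compose_fst[OF h(2)] by blast+
qed

text \<open>Let \<open>g\<close> be the claimed projection and \<open>h\<close> in the Bergman space. Since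
  \<open>inverse z\<^sub>1 = cnj z\<^sub>1 / \<bar>z\<^sub>1\<bar>\<^sup>2\<close>, the product \<open>(f - g) * cnj h\<close> is the conjugate of a radial
  function \<open>P\<close> times the holomorphic function \<open>z\<^sub>1\<^sup>n h\<close>. By \<open>hartogs_radial_mean\<close> its integral is a
  multiple of the integral of \<open>P\<close>, and \<open>K\<close> is the constant for which that integral is \<open>0\<close>.\<close>

lemma projection_of_monomial:
  fixes n :: nat and s K :: real
  defines "f \<equiv> \<lambda>z :: complex \<times> complex. cmod (fst z) powr (2 * real n - s) *\<^sub>R inverse (fst z) ^ n"
  defines "K \<equiv> moment s / moment (2 * real n)"
  assumes n: "1 \<le> n" and s: "s > real n"
  shows "f \<in> Lp_space 2 hartogs_triangle hartogs_weight"
    and "bergman_projection hartogs_triangle hartogs_weight f =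
      (\<lambda>z. if z \<in> hartogs_triangle then K *\<^sub>R inverse (fst z) ^ n else 0)"
proof -
  let ?H = hartogs_triangle and ?\<mu> = hartogs_weight
  define g where "g z = (if z \<in> ?H then K *\<^sub>R inverse (fst z) ^ n else 0)" for z
  have cont_inv: "continuous_on ?H (\<lambda>z. inverse (fst z) ^ n)"
    by (rule holomorphic2_on_imp_continuous_on[OF fst_power_holomorphic(2)])
  have norm_inv: "cmod (inverse (fst z) ^ n) = cmod (fst z) powr (- real n)" if "z \<in> ?H" for z
    using hartogs_fst[OF that] by (simp add: norm_power norm_inverse powr_minus powr_realpow power_inverse)
  have fm: "f \<in> borel_measurable hartogs_measure"
    unfolding f_def by (intro hartogs.continuous_imp_measurable_W continuous_intros continuous_on_powr_radial cont_inv)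
  have "integrable hartogs_measure (\<lambda>z. (cmod (f z))\<^sup>2) \<longleftrightarrow>
      integrable hartogs_measure (\<lambda>z. cmod (fst z) powr (- (2 * (s - real n))))"
  proof (rule Bochner_Integration.integrable_cong[OF refl])
    fix z assume "z \<in> space hartogs_measure"
    then have z: "z \<in> ?H" by simp
    have "cmod (f z) = cmod (fst z) powr (- (s - real n))"
      by (simp add: f_def norm_inv[OF z] flip: powr_add)
    then show "(cmod (f z))\<^sup>2 = cmod (fst z) powr (- (2 * (s - real n)))"
      by (simp add: power2_eq_square flip: powr_add)
  qed
  then show fL2: "f \<in> Lp_space 2 ?H ?\<mu>"
    unfolding hartogs.L2_space_iff using fm s moment_integrable[of "2 * (s - real n)"] by simp
  have "integrable hartogs_measure (\<lambda>z. (cmod (g z))\<^sup>2) \<longleftrightarrow>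
      integrable hartogs_measure (\<lambda>z. K\<^sup>2 * cmod (fst z) powr (- (2 * real n)))"
  proof (rule Bochner_Integration.integrable_cong[OF refl])
    fix z assume "z \<in> space hartogs_measure"
    then have z: "z \<in> ?H" by simp
    have "(cmod (fst z) powr (- real n))\<^sup>2 = cmod (fst z) powr (- (2 * real n))"
      by (simp add: power2_eq_square flip: powr_add)
    then show "(cmod (g z))\<^sup>2 = K\<^sup>2 * cmod (fst z) powr (- (2 * real n))"
      using norm_inv[OF z] z by (simp add: g_def power_mult_distrib)
  qed
  then have gi: "integrable hartogs_measure (\<lambda>z. (cmod (g z))\<^sup>2)"
    using n moment_integrable[of "2 * real n"] by simp
  have ghol: "g holomorphic2_on ?H"
  proof -
    have "(\<lambda>z. of_real K * inverse (fst z) ^ n) holomorphic2_on ?H"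
      by (intro holomorphic2_on_cmult fst_power_holomorphic)
    moreover have "(g has_derivative D) (at z within ?H)"
      if "((\<lambda>z. of_real K * inverse (fst z) ^ n) has_derivative D) (at z within ?H)" "z \<in> ?H" for D z
      by (rule has_derivative_transform[OF that(2) _ that(1)]) (simp add: g_def scaleR_conv_of_real)
    ultimately show ?thesis unfolding holomorphic2_on_def by blast
  qed
  have gB: "g \<in> bergman_space ?H ?\<mu>"
    unfolding bergman_space_def hartogs.L2_space_iff
    using gi ghol hartogs.continuous_imp_measurable_W[OF holomorphic2_on_imp_continuous_on[OF ghol]] by simp
  have orth: "L2_inner ?H ?\<mu> (\<lambda>z. f z - g z) h = 0" if h: "h \<in> bergman_space ?H ?\<mu>" for h
  proof -
    define P where "P r = r powr (- s) - K * r powr (- (2 * real n))" for r :: real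
    let ?F = "\<lambda>z. fst z ^ n * h z"
    have Fhol: "?F holomorphic2_on ?H"
      by (intro holomorphic2_on_mult fst_power_holomorphic hartogs.bergman_holomorphic[OF h])
    have eq: "(f z - g z) * cnj (h z) = cnj (P (cmod (fst z)) *\<^sub>R ?F z)" if z: "z \<in> ?H" for z
    proof -
      let ?r = "cmod (fst z)"
      have r: "?r > 0" using hartogs_fst[OF z] by simp
      have "inverse (fst z) = ?r powr (- 2) *\<^sub>R cnj (fst z)"
        using r complex_norm_square[of "fst z"]
        by (simp add: powr_minus field_simps scaleR_conv_of_real)
      then have "inverse (fst z) ^ n = (?r powr (- 2)) ^ n *\<^sub>R cnj (fst z) ^ n"
        by (simp only: scaleR_power)
      also have "(?r powr (- 2)) ^ n = ?r powr (- (2 * real n))"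
      proof -
        have "(?r powr (- 2)) ^ n = (?r powr (- 2)) powr real n" using r by (simp only: powr_realpow powr_gt_zero)
        then show ?thesis by (simp add: powr_powr)
      qed
      finally have "inverse (fst z) ^ n = (?r powr (- (2 * real n))) *\<^sub>R cnj (fst z) ^ n" .
      moreover have "?r powr (2 * real n - s) * ?r powr (- (2 * real n)) = ?r powr (- s)"
        by (simp flip: powr_add)
      ultimately have "f z - g z = P ?r *\<^sub>R cnj (fst z) ^ n"
        using z by (simp add: f_def g_def P_def scaleR_left_diff_distrib)
      then show ?thesis by simp
    qed
    have contP: "continuous_on {0<..<1} P" unfolding P_def by (intro continuous_intros) auto
    have i1: "integrable hartogs_measure (\<lambda>z. cmod (fst z) powr (- s))"
      and i2: "integrable hartogs_measure (\<lambda>z. cmod (fst z) powr (- (2 * real n)))"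
      using n s by (auto intro!: moment_integrable[of "2 * real n"] moment_integrable[of s])
    then have intP: "integrable hartogs_measure (\<lambda>z. P (cmod (fst z)))"
      unfolding P_def by simp
    have "integrable hartogs_measure (\<lambda>z. (f z - g z) * cnj (h z))"
      by (intro hartogs.L2_inner_integrable hartogs.L2_diff fL2 hartogs.bergman_L2 gB h)
    then have "integrable hartogs_measure (\<lambda>z. cnj (P (cmod (fst z)) *\<^sub>R ?F z))"
      by (rule iffD1[OF Bochner_Integration.integrable_cong[OF refl], rotated]) (simp add: eq)
    from integrable_bounded_linear[OF bounded_linear_cnj this]
    have intF: "integrable hartogs_measure (\<lambda>z. P (cmod (fst z)) *\<^sub>R ?F z)"
      by (simp only: complex_cnj_cnj)
    obtain c where c: "(\<integral>z. P (cmod (fst z)) *\<^sub>R ?F z \<partial>hartogs_measure) =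
        (\<integral>z. P (cmod (fst z)) \<partial>hartogs_measure) *\<^sub>R c"
      using hartogs_radial_mean[OF Fhol contP intP intF] .
    have "(\<integral>z. P (cmod (fst z)) \<partial>hartogs_measure) = moment s - K * moment (2 * real n)"
      unfolding P_def moment_def using i1 i2 by simp
    also have "\<dots> = 0" using moment_pos[of "2 * real n"] n by (simp add: K_def)
    finally have zero: "(\<integral>z. P (cmod (fst z)) *\<^sub>R ?F z \<partial>hartogs_measure) = 0" using c by simp
    have "L2_inner ?H ?\<mu> (\<lambda>z. f z - g z) h = (\<integral>z. cnj (P (cmod (fst z)) *\<^sub>R ?F z) \<partial>hartogs_measure)"
      unfolding L2_inner_def by (rule Bochner_Integration.integral_cong[OF refl]) (simp add: eq)
    also have "\<dots> = 0" unfolding Bochner_Integration.integral_cnj zero by simp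
    finally show ?thesis .
  qed
  have "bergman_projection ?H ?\<mu> f = g"
    using fL2 gB _ orth by (rule hartogs.bergman_projection_eqI) (simp add: g_def)
  then show "bergman_projection ?H ?\<mu> f = (\<lambda>z. if z \<in> ?H then K *\<^sub>R inverse (fst z) ^ n else 0)"
    by (simp add: g_def[abs_def])
qed

text \<open>The function \<open>f\<close> below has modulus \<open>\<bar>z\<^sub>1\<bar>\<^sup>n\<^sup>(\<^sup>1\<^sup>-\<^sup>q\<^sup>)\<close>, so the integral of \<open>\<bar>f\<bar>\<^sup>p\<close> is
  \<open>moment (n q)\<close>; its projection is \<open>moment (n q) / moment (2 n)\<close> times \<open>z\<^sub>1\<^sup>-\<^sup>n\<close>.\<close>

lemma bounded_imp_moment_inequality:
  assumes p: "p > 1" and q: "1 / p + 1 / q = 1"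
    and bdd: "bergman_projection_bounded p hartogs_triangle hartogs_weight"
  obtains C where "C > 0" "\<And>n :: nat. n \<ge> 1 \<Longrightarrow>
    moment (real n * q) powr (1 / q) * moment (real n * p) powr (1 / p) \<le> C * moment (2 * real n)"
proof -
  obtain C where C: "C > 0" and bound: "\<And>f. f \<in> Lp_space 2 hartogs_triangle hartogs_weight \<Longrightarrow>
      f \<in> Lp_space p hartogs_triangle hartogs_weight \<Longrightarrow>
      Lp_norm p hartogs_triangle hartogs_weight (bergman_projection hartogs_triangle hartogs_weight f)
        \<le> C * Lp_norm p hartogs_triangle hartogs_weight f"
    using bdd unfolding bergman_projection_bounded_def by blast
  have "1 / q = (p - 1) / p" using p q by (simp add: field_simps)
  then have qp: "q = p / (p - 1)" by (metis inverse_divide inverse_eq_divide inverse_inverse_eq)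
  then have q1: "q > 1" using p by simp
  have "moment (real n * q) powr (1 / q) * moment (real n * p) powr (1 / p) \<le> C * moment (2 * real n)"
    if n: "n \<ge> 1" for n :: nat
  proof -
    let ?H = hartogs_triangle and ?\<mu> = hartogs_weight
    let ?f = "\<lambda>z :: complex \<times> complex. cmod (fst z) powr (2 * real n - real n * q) *\<^sub>R inverse (fst z) ^ n"
    define K where "K = moment (real n * q) / moment (2 * real n)"
    have nq: "real n * q > real n" using n q1 by simp
    have nq1: "real n * q \<ge> 1" and np1: "real n * p \<ge> 1" using mult_mono[of 1 "real n" 1 q] mult_mono[of 1 "real n" 1 p] n p q1 by simp_all
    have pos: "moment (real n * q) > 0" "moment (real n * p) > 0" "moment (2 * real n) > 0"
      using nq1 np1 n by (auto intro!: moment_pos)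
    have K: "K > 0" using pos by (simp add: K_def)
    note proj = projection_of_monomial[OF n nq]
    have norm_inv: "cmod (inverse (fst z) ^ n) = cmod (fst z) powr (- real n)" if "z \<in> ?H" for z
      using hartogs_fst[OF that] by (simp add: norm_power norm_inverse powr_minus powr_realpow power_inverse)
    have fp: "cmod (?f z) powr p = cmod (fst z) powr (- (real n * q))" if z: "z \<in> ?H" for z
    proof -
      have "cmod (?f z) = cmod (fst z) powr (real n - real n * q)"
        by (simp add: norm_inv[OF z] flip: powr_add)
      moreover have "(real n - real n * q) * p = - (real n * q)" using p by (simp add: qp field_simps)
      ultimately show ?thesis by (simp add: powr_powr)
    qed
    have fi: "integrable hartogs_measure (\<lambda>z. cmod (?f z) powr p)"
      using moment_integrable[of "real n * q"] nq
      by (subst Bochner_Integration.integrable_cong[OF refl fp]) auto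
    have f_norm: "Lp_norm p ?H ?\<mu> ?f = moment (real n * q) powr (1 / p)"
      unfolding Lp_norm_def moment_def by (subst Bochner_Integration.integral_cong[OF refl fp]) auto
    have "?f \<in> Lp_space p ?H ?\<mu>"
      using fi hartogs.L2_measurable[OF proj(1)] by (simp add: hartogs.Lp_space_iff)
    from bound[OF proj(1) this] have le: "Lp_norm p ?H ?\<mu> (bergman_projection ?H ?\<mu> ?f) \<le> C * moment (real n * q) powr (1 / p)"
      by (simp add: f_norm)
    have gp: "cmod (if z \<in> ?H then K *\<^sub>R inverse (fst z) ^ n else 0) powr p =
        K powr p * cmod (fst z) powr (- (real n * p))" if z: "z \<in> ?H" for z
    proof -
      have "cmod (K *\<^sub>R inverse (fst z) ^ n) = K * cmod (fst z) powr (- real n)"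
        using K norm_inv[OF z] by simp
      then show ?thesis using z K by (simp add: powr_mult powr_powr)
    qed
    have "Lp_norm p ?H ?\<mu> (bergman_projection ?H ?\<mu> ?f) = (K powr p * moment (real n * p)) powr (1 / p)"
      unfolding proj(2) Lp_norm_def K_def[symmetric]
      by (subst Bochner_Integration.integral_cong[OF refl gp]) (auto simp: moment_def)
    also have "\<dots> = K * moment (real n * p) powr (1 / p)"
      using K pos p by (simp add: powr_mult powr_powr)
    finally have "K * moment (real n * p) powr (1 / p) \<le> C * moment (real n * q) powr (1 / p)"
      using le by simp
    then have "moment (real n * q) * moment (real n * p) powr (1 / p) \<le> C * moment (2 * real n) * moment (real n * q) powr (1 / p)"
      using pos by (simp add: K_def field_simps)
    moreover have "moment (real n * q) = moment (real n * q) powr (1 / q) * moment (real n * q) powr (1 / p)"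
      using pos q by (simp add: add.commute flip: powr_add)
    ultimately have "moment (real n * q) powr (1 / p) * (moment (real n * q) powr (1 / q) * moment (real n * p) powr (1 / p))
        \<le> moment (real n * q) powr (1 / p) * (C * moment (2 * real n))"
      by (simp add: mult_ac)
    then show ?thesis using pos by (simp add: mult_le_cancel_left)
  qed
  then show ?thesis using that C by blast
qed

section \<open>Unboundedness for exponents other than two\<close>

text \<open>For \<open>a\<close> the \<open>(k+1)\<close>-st root of \<open>b\<close>, eventually \<open>n \<le> a\<^sup>n\<close>, so \<open>n\<^sup>k\<^sup>+\<^sup>1 \<le> b\<^sup>n\<close>.\<close>

lemma exponential_not_polynomially_bounded:
  fixes b D :: real
  assumes "b > 1"
  shows "\<exists>n::nat. n \<ge> 1 \<and> D * real n ^ k < b ^ n"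
proof -
  define a where "a = root (Suc k) b"
  have a: "a > 1" "a ^ Suc k = b"
    using assms real_root_pow_pos[of "Suc k" b] by (simp_all add: a_def del: power_Suc)
  have "(\<lambda>n. of_nat n / a ^ n) \<longlonglongrightarrow> 0" using a by (intro lim_n_over_pown) simp
  then have "\<forall>\<^sub>F n in sequentially. real n / a ^ n < 1" by (rule order_tendstoD) simp
  moreover have "\<forall>\<^sub>F n in sequentially. n \<ge> max 1 (Suc (nat \<lceil>D\<rceil>))" by (rule eventually_ge_at_top)
  ultimately have "\<forall>\<^sub>F n in sequentially. real n / a ^ n < 1 \<and> n \<ge> max 1 (Suc (nat \<lceil>D\<rceil>))"
    by (rule eventually_conj)
  then obtain n where n: "real n / a ^ n < 1" "n \<ge> 1" "n \<ge> Suc (nat \<lceil>D\<rceil>)"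
    unfolding eventually_sequentially by auto
  have D: "D < real n" using n(3) by linarith
  have "D * real n ^ k < real n * real n ^ k" using D n(2) by (intro mult_strict_right_mono) auto
  also have "\<dots> = real n ^ Suc k" by simp
  also have "\<dots> \<le> (a ^ n) ^ Suc k" using n(1) a by (intro power_mono) (auto simp: divide_less_eq)
  also have "\<dots> = b ^ n" using a(2) by (metis power_mult mult.commute)
  finally show ?thesis using n(2) by blast
qed

lemma moment_powr_lower:
  assumes \<kappa>: "\<kappa> > 0" "\<And>s. s \<ge> 1 \<Longrightarrow> \<kappa> * s powr (s - 8) * exp (- s) \<le> moment s"
    and n: "n \<ge> (1::nat)" and x: "x > 1"
  shows "\<kappa> powr (1 / x) * (real n * x) powr (real n - 8 / x) * exp (- real n) \<le> moment (real n * x) powr (1 / x)"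
proof -
  have nx: "real n * x \<ge> 1" using mult_mono[of 1 "real n" 1 x] n x by simp
  have "(\<kappa> * (real n * x) powr (real n * x - 8) * exp (- (real n * x))) powr (1 / x) \<le> moment (real n * x) powr (1 / x)"
    using \<kappa>(1) \<kappa>(2)[OF nx] x by (intro powr_mono2) auto
  also have "(\<kappa> * (real n * x) powr (real n * x - 8) * exp (- (real n * x))) powr (1 / x) =
      \<kappa> powr (1 / x) * (real n * x) powr (real n - 8 / x) * exp (- real n)"
  proof -
    have "exp (- (real n * x)) powr (1 / x) = exp (- real n)" using x by (simp add: powr_def)
    moreover have "(real n * x - 8) * (1 / x) = real n - 8 / x" using x by (simp add: field_simps)
    ultimately show ?thesis using \<kappa> nx by (simp add: powr_mult powr_powr)
  qed
  finally show ?thesis .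
qed

text \<open>After cancelling \<open>n\<^sup>2\<^sup>n e\<^sup>-\<^sup>2\<^sup>n\<close>, the moment inequality bounds \<open>(p q / 4)\<^sup>n\<close> by a constant times
  \<open>n\<^sup>8\<close>: the exponents \<open>8 / p\<close> and \<open>8 / q\<close> of the polynomial losses add up to \<open>8\<close>. But
  \<open>p q = p\<^sup>2 / (p - 1)\<close> exceeds \<open>4\<close> by \<open>(p - 2)\<^sup>2 / (p - 1)\<close>.\<close>

lemma hartogs_unbounded:
  assumes p: "p > 1" "p \<noteq> 2"
  shows "\<not> bergman_projection_bounded p hartogs_triangle hartogs_weight"
proof
  assume bdd: "bergman_projection_bounded p hartogs_triangle hartogs_weight"
  define q where "q = p / (p - 1)"
  have q1: "q > 1" using p by (simp add: q_def)
  have pq: "1 / p + 1 / q = 1" using p by (simp add: q_def field_simps)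
  obtain C where C: "C > 0" "\<And>n :: nat. n \<ge> 1 \<Longrightarrow>
      moment (real n * q) powr (1 / q) * moment (real n * p) powr (1 / p) \<le> C * moment (2 * real n)"
    using bounded_imp_moment_inequality[OF p(1) pq bdd] by blast
  obtain \<kappa> where \<kappa>: "\<kappa> > 0" "\<And>s. s \<ge> 1 \<Longrightarrow> \<kappa> * s powr (s - 8) * exp (- s) \<le> moment s"
    using moment_lower by blast
  define V where "V = measure lborel hartogs_triangle"
  have V: "V \<ge> 0" by (simp add: V_def)
  define b where "b = p * q / 4"
  have b: "b > 1"
  proof -
    have "(p - 2)\<^sup>2 > 0" using p by simp
    then have "4 * (p - 1) < p * p" by (simp add: power2_eq_square algebra_simps)
    then show ?thesis using p by (simp add: b_def q_def field_simps)
  qed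
  define D where "D = C * V * (p * q) ^ 8 / \<kappa>"
  obtain n :: nat where n: "n \<ge> 1" "D * real n ^ 8 < b ^ n"
    using exponential_not_polynomially_bounded[OF b] by blast
  have np: "real n * p \<ge> 1" "real n * q \<ge> 1"
    using mult_mono[of 1 "real n" 1 q] mult_mono[of 1 "real n" 1 p] n p q1 by simp_all
  have "(\<kappa> powr (1 / q) * (real n * q) powr (real n - 8 / q) * exp (- real n)) *
      (\<kappa> powr (1 / p) * (real n * p) powr (real n - 8 / p) * exp (- real n)) \<le>
      moment (real n * q) powr (1 / q) * moment (real n * p) powr (1 / p)"
    using moment_powr_lower[OF \<kappa> n(1) q1] moment_powr_lower[OF \<kappa> n(1) p(1)] by (intro mult_mono) auto
  also have "\<dots> \<le> C * moment (2 * real n)" using C n by blast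
  also have "\<dots> \<le> C * (V * ((2 * real n) powr (2 * real n) * exp (- (2 * real n))))"
    using moment_upper[of "2 * real n"] C n by (intro mult_left_mono) (auto simp: V_def)
  finally have main: "(\<kappa> powr (1 / q) * (real n * q) powr (real n - 8 / q) * exp (- real n)) *
      (\<kappa> powr (1 / p) * (real n * p) powr (real n - 8 / p) * exp (- real n)) \<le>
      C * V * (2 * real n) powr (2 * real n) * exp (- (2 * real n))" by simp
  have kk: "\<kappa> powr (1 / q) * \<kappa> powr (1 / p) = \<kappa>"
    using \<kappa> pq by (simp add: add.commute flip: powr_add)
  have ee: "exp (- real n) * exp (- real n) = exp (- (2 * real n))" by (simp flip: exp_add)
  have split: "(real n * x) powr (real n - 8 / x) = (real n * x) ^ n / (real n * x) powr (8 / x)" if "real n * x \<ge> 1" for x :: real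
    using that by (simp add: powr_diff powr_realpow)
  have poly: "(real n * q) powr (8 / q) * (real n * p) powr (8 / p) \<le> (real n * p * q) ^ 8"
  proof -
    have "(real n * q) powr (8 / q) * (real n * p) powr (8 / p) \<le> (real n * p * q) powr (8 / q) * (real n * p * q) powr (8 / p)"
    proof -
      have "real n * q \<le> real n * p * q" "real n * p \<le> real n * p * q"
        using mult_left_mono[of 1 p "real n * q"] mult_left_mono[of 1 q "real n * p"] np p q1
        by (simp_all add: mult_ac)
      then show ?thesis using np p q1 by (intro mult_mono[OF powr_mono2 powr_mono2]) auto
    qed
    also have "\<dots> = (real n * p * q) powr 8"
    proof -
      have "8 / q + 8 / p = 8" using pq by (simp add: field_simps)
      then show ?thesis by (simp flip: powr_add)
    qed
    finally show ?thesis using n p q1 by (simp add: powr_realpow flip: powr_numeral)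
  qed
  let ?L = "(real n * q) powr (8 / q) * (real n * p) powr (8 / p)"
  have L: "?L > 0" using n p q1 by simp
  have regroup: "(a * (X / u) * E) * (a' * (Y / w) * E) = (a * a') * (X * Y) / (u * w) * (E * E)"
    for a a' X Y u w E :: real by simp
  have "(\<kappa> * ((real n * q) ^ n * (real n * p) ^ n) / ?L) * exp (- (2 * real n)) \<le>
      (C * V * (2 * real n) powr (2 * real n)) * exp (- (2 * real n))"
    using main unfolding split[OF np(1)] split[OF np(2)] regroup kk ee .
  then have "\<kappa> * ((real n * q) ^ n * (real n * p) ^ n) / ?L \<le> C * V * (2 * real n) powr (2 * real n)"
    by (simp only: mult_le_cancel_right) simp
  then have "\<kappa> * ((real n * q) ^ n * (real n * p) ^ n) \<le> C * V * (2 * real n) powr (2 * real n) * ?L"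
    using L by (simp only: pos_divide_le_eq)
  also have "\<dots> \<le> C * V * (2 * real n) powr (2 * real n) * (real n * p * q) ^ 8"
    using C V poly by (intro mult_left_mono) auto
  also have "(2 * real n) powr (2 * real n) = (4 * real n * real n) ^ n"
  proof -
    have "(2 * real n) powr (2 * real n) = (2 * real n) powr real (2 * n)" by simp
    also have "\<dots> = (2 * real n) ^ (2 * n)" using n by (intro powr_realpow) simp
    also have "(2 * real n) ^ (2 * n) = ((2 * real n)\<^sup>2) ^ n" by (rule power_mult)
    also have "(2 * real n)\<^sup>2 = 4 * real n * real n" by (simp add: power2_eq_square)
    finally show ?thesis .
  qed
  finally have "\<kappa> * (((real n * q) * (real n * p)) ^ n) \<le> C * V * (4 * real n * real n) ^ n * (real n * p * q) ^ 8"
    by (simp only: power_mult_distrib)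
  moreover have "(real n * q) * (real n * p) = (4 * real n * real n) * b" by (simp add: b_def)
  ultimately have "\<kappa> * ((4 * real n * real n) ^ n * b ^ n) \<le>
      C * V * (4 * real n * real n) ^ n * (real n * p * q) ^ 8"
    by (simp only: power_mult_distrib[of "4 * real n * real n" b])
  then have "(4 * real n * real n) ^ n * (\<kappa> * b ^ n) \<le>
      (4 * real n * real n) ^ n * (C * V * (real n * p * q) ^ 8)"
    by (simp only: mult_ac)
  then have "\<kappa> * b ^ n \<le> C * V * (real n * p * q) ^ 8"
    using n by (simp add: mult_le_cancel_left)
  then have "b ^ n \<le> D * real n ^ 8"
    using \<kappa> by (simp add: D_def field_simps power_mult_distrib)
  with n show False by simp
qed

theorem theorem1p1:
  fixes p :: real
  assumes "1 < p"
  shows "bergman_projection_bounded p hartogs_triangle hartogs_weight \<longleftrightarrow> p = 2"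
  using hartogs_unbounded[OF assms] hartogs.bergman_projection_bounded_2 by blast

end
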